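(* (i) There exist equations of state $e=\bar e(\tau,S)$, $\tau>0$, $S\in\mathbb R$, such that: (a) all of the following hold. - For $\tau>0$, $S\in\mathbb R$: $\bar e>0$; $p=-\bar e_\tau>0$; $T=\bar e_S>0$; $p_\tau=-\bar e_{\tau\tau}<0$; $p_{\tau\tau}=-\bar e_{\tau\tau\tau}>0$; $p_S=-\bar e_{\tau S}>0$. - For $\tau, e>0$, the pressure law $\hat p(\tau,e)$ satisfies $\hat p>0$; $(\partial_\tau-\hat p\,\partial_e)\hat p<0$; $(\partial_\tau-\hat p\,\partial_e)^2\hat p>0$; $\hat p_e>0$. - For each $\tau>0$: $\lim_{S\to-\infty}\bar e(\tau,S)=0$, $\lim_{S\to+\infty}\bar e(\tau,S)=\infty$, $\lim_{S\to-\infty}-\bar e_\tau(\tau,S)=0$, $\lim_{S\to+\infty}-\bar e_\tau(\tau,S)=\infty$. - $\lim_{\tau\to0^+}\check e(\tau,p)=0$ for each $p>0$, and $\lim_{\tau\to+\infty}\bar e(\tau,S)=0$ for each $S\in\mathbb R$. - In particular, the largest and smallest characteristic speeds of the Euler equations are simple and genuinely nonlinear; entropy $S$ and shock speed $\sigma$ are monotone along the forward $1$- and $3$-Hugoniot curves; and there is a global concave entropy function $S=\hat S(\tau,e)$ defined on $\tau,e>0$. (b) The corresponding Euler equations admit inviscidly unstable Lax shock waves. (ii) For all sufficiently large $C$, the equation of state $$\bar e(\tau,S)=\frac{e^{S}}{\tau}+C^2e^{S/C^2-\tau/C}$$ is an example for (i).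
   Context: The Euler equations of gas dynamics in Lagrangian coordinates, for $U=(\tau,v,e)$ ($\tau>0$ specific volume, $v\in\mathbb R$ velocity, $e>0$ specific internal energy), are $$\tau_t-v_x=0,\quad v_t+p_x=0,\quad (e+v^2/2)_t+(vp)_x=0 .$$ Given an equation of state $e=\bar e(\tau,S)$ ($S$ = entropy) with $T=\bar e_S>0$, let $S=\hat S(\tau,e)$ be its inverse for fixed $\tau$ and close the system by $p=\hat p(\tau,e):=-\bar e_\tau(\tau,\hat S(\tau,e))$; also write $p(\tau,S)=-\bar e_\tau(\tau,S)$. When $p_S>0$, solving $p=-\bar e_\tau(\tau,S)$ for $S=\check S(\tau,p)$ defines $\check e(\tau,p):=\bar e(\tau,\check S(\tau,p))$. The characteristic speeds are $-c,0,c$ with $c=\sqrt{-p_\tau(\tau,S)}=\sqrt{p\hat p_e-\hat p_\tau}$. (In $e^S$ etc. the letter $e$ is the base of the natural exponential.) Write $[g]=g(U_+)-g(U_-)$. A shock $(U_-,U_+)$ of speed $\sigma$ satisfies the Rankine–Hugoniot conditions $\sigma[\tau]=-[v]$, $\sigma[v]=[p]$, $\sigma[e+v^2/2]=[vp]$. It is a Lax $1$-shock if $\sigma<-c_-$ and $-c_+<\sigma<0$, and a Lax $3$-shock if $0<\sigma<c_-$ and $c_+<\sigma$. The forward $k$-Hugoniot curve through $U_-$ is the curve of all right states $U_+$ connected to $U_-$ by a Lax $k$-shock. Lopatinski determinant: let $f^0=(\tau,v,e+v^2/2)^T$, $A^0=\partial f^0/\partial(\tau,v,e)$, and, in coordinates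 $(\tau,v,e)$, $r_1=(1,c,-p)^T$, $r_2=(-\hat p_e,0,\hat p_\tau)^T$, $r_3=(1,-c,-p)^T$ (eigenvectors for $-c,0,c$). For a Lax $1$-shock, $\delta=\det([f^0],A^0_+r_2^+,A^0_+r_3^+)$; for a Lax $3$-shock, $\delta=\det(A^0_-r_1^-,A^0_-r_2^-,[f^0])$. The signed Lopatinski determinant of a $k$-shock $(U_-,U_+)$ is $\Delta=\delta(1)/\lim_{\alpha\searrow0}\operatorname{sgn}\delta(\alpha)$, where $\delta(\alpha)$ is the Lopatinski determinant along any continuous family $(U^-(\alpha),U^+(\alpha))$, $0<\alpha\le1$, of Lax $k$-shocks with $U^\pm(1)=U_\pm$ and $U^\pm(0+)=U_*$ for a common state $U_*$ (the sign of $\Delta$ being independent of the family). A shock is inviscidly stable if $\Delta>0$ and inviscidly unstable if $\Delta<0$. *)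

theory Defs
  imports "HOL-Analysis.Analysis" "HOL-Computational_Algebra.Polynomial"
begin

section \<open>Partial derivatives and smoothness of functions of two real variables\<close>

definition pd1 :: "(real \<Rightarrow> real \<Rightarrow> real) \<Rightarrow> real \<Rightarrow> real \<Rightarrow> real" where
  "pd1 f x y = deriv (\<lambda>t. f t y) x"

definition pd2 :: "(real \<Rightarrow> real \<Rightarrow> real) \<Rightarrow> real \<Rightarrow> real \<Rightarrow> real" where
  "pd2 f x y = deriv (\<lambda>t. f x t) y"

primrec C_k_on :: "nat \<Rightarrow> (real \<times> real) set \<Rightarrow> (real \<Rightarrow> real \<Rightarrow> real) \<Rightarrow> bool" where
  "C_k_on 0 D f \<longleftrightarrow> continuous_on D (\<lambda>(x, y). f x y)"
| "C_k_on (Suc k) D f \<longleftrightarrow>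
     (\<forall>z\<in>D. (\<lambda>(x, y). f x y) differentiable (at z)) \<and> C_k_on k D (pd1 f) \<and> C_k_on k D (pd2 f)"


section \<open>Equations of state and the derived thermodynamic functions\<close>

text \<open>An equation of state is a function \<open>E \<tau> S\<close>, of which only the values for \<open>\<tau> > 0\<close>
  matter.  Smoothness on \<open>\<tau> > 0\<close> is required explicitly, so that \<^const>\<open>deriv\<close> never
  denotes an unspecified value at the points where it is used.\<close>

definition smooth_eos :: "(real \<Rightarrow> real \<Rightarrow> real) \<Rightarrow> bool" where
  "smooth_eos E \<longleftrightarrow> (\<forall>k. C_k_on k ({0<..} \<times> UNIV) E)"

definition pressure :: "(real \<Rightarrow> real \<Rightarrow> real) \<Rightarrow> real \<Rightarrow> real \<Rightarrow> real" where
  "pressure E \<tau> S = - pd1 E \<tau> S"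

definition temperature :: "(real \<Rightarrow> real \<Rightarrow> real) \<Rightarrow> real \<Rightarrow> real \<Rightarrow> real" where
  "temperature E \<tau> S = pd2 E \<tau> S"

definition S_hat :: "(real \<Rightarrow> real \<Rightarrow> real) \<Rightarrow> real \<Rightarrow> real \<Rightarrow> real" where
  "S_hat E \<tau> e = (THE S. E \<tau> S = e)"

definition p_hat :: "(real \<Rightarrow> real \<Rightarrow> real) \<Rightarrow> real \<Rightarrow> real \<Rightarrow> real" where
  "p_hat E \<tau> e = pressure E \<tau> (S_hat E \<tau> e)"

definition S_check :: "(real \<Rightarrow> real \<Rightarrow> real) \<Rightarrow> real \<Rightarrow> real \<Rightarrow> real" where
  "S_check E \<tau> p = (THE S. pressure E \<tau> S = p)"

definition e_check :: "(real \<Rightarrow> real \<Rightarrow> real) \<Rightarrow> real \<Rightarrow> real \<Rightarrow> real" where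
  "e_check E \<tau> p = E \<tau> (S_check E \<tau> p)"

definition isentropic_deriv ::
    "(real \<Rightarrow> real \<Rightarrow> real) \<Rightarrow> (real \<Rightarrow> real \<Rightarrow> real) \<Rightarrow> real \<Rightarrow> real \<Rightarrow> real" where
  "isentropic_deriv E g \<tau> e = pd1 g \<tau> e - p_hat E \<tau> e * pd2 g \<tau> e"


section \<open>The Euler equations\<close>

text \<open>A state is \<open>U = (\<tau>, v, e)\<close>, i.e. \<open>U $ 1 = \<tau>\<close>, \<open>U $ 2 = v\<close>, \<open>U $ 3 = e\<close>, and the
  equations read \<open>(f0 U)\<^sub>t + (f1 U)\<^sub>x = 0\<close>.\<close>

definition states :: "(real ^ 3) set" where
  "states = {U. U $ 1 > 0 \<and> U $ 3 > 0}"

definition f0 :: "real ^ 3 \<Rightarrow> real ^ 3" where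
  "f0 U = vector [U $ 1, U $ 2, U $ 3 + (U $ 2)\<^sup>2 / 2]"

definition p_state :: "(real \<Rightarrow> real \<Rightarrow> real) \<Rightarrow> real ^ 3 \<Rightarrow> real" where
  "p_state E U = p_hat E (U $ 1) (U $ 3)"

definition S_state :: "(real \<Rightarrow> real \<Rightarrow> real) \<Rightarrow> real ^ 3 \<Rightarrow> real" where
  "S_state E U = S_hat E (U $ 1) (U $ 3)"

definition f1 :: "(real \<Rightarrow> real \<Rightarrow> real) \<Rightarrow> real ^ 3 \<Rightarrow> real ^ 3" where
  "f1 E U = vector [- U $ 2, p_state E U, U $ 2 * p_state E U]"

definition A0 :: "real ^ 3 \<Rightarrow> real ^ 3 ^ 3" where
  "A0 U = jacobian f0 (at U)"

definition A1 :: "(real \<Rightarrow> real \<Rightarrow> real) \<Rightarrow> real ^ 3 \<Rightarrow> real ^ 3 ^ 3" where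
  "A1 E U = jacobian (f1 E) (at U)"

definition sound_speed :: "(real \<Rightarrow> real \<Rightarrow> real) \<Rightarrow> real ^ 3 \<Rightarrow> real" where
  "sound_speed E U = sqrt (- pd1 (pressure E) (U $ 1) (S_state E U))"

text \<open>Characteristic speeds are the roots of \<open>det (A1 - \<lambda> A0)\<close>; the determinant is taken in the
  polynomial ring so that the algebraic multiplicity of a root is available as its \<^const>\<open>order\<close>.\<close>

definition euler_char_poly :: "(real \<Rightarrow> real \<Rightarrow> real) \<Rightarrow> real ^ 3 \<Rightarrow> real poly" where
  "euler_char_poly E U = det (\<chi> i j. [: A1 E U $ i $ j, - (A0 U $ i $ j) :])"

definition char_speeds :: "(real \<Rightarrow> real \<Rightarrow> real) \<Rightarrow> real ^ 3 \<Rightarrow> real set" where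
  "char_speeds E U = {l. poly (euler_char_poly E U) l = 0}"

definition simple_speed :: "(real \<Rightarrow> real \<Rightarrow> real) \<Rightarrow> (real ^ 3 \<Rightarrow> real) \<Rightarrow> bool" where
  "simple_speed E lam \<longleftrightarrow>
     (\<forall>U\<in>states. euler_char_poly E U \<noteq> 0 \<and> lam U \<in> char_speeds E U
        \<and> order (lam U) (euler_char_poly E U) = 1)"

definition genuinely_nonlinear :: "(real \<Rightarrow> real \<Rightarrow> real) \<Rightarrow> (real ^ 3 \<Rightarrow> real) \<Rightarrow> bool" where
  "genuinely_nonlinear E lam \<longleftrightarrow>
     (\<forall>U\<in>states. lam differentiable (at U) \<and>
        (\<forall>r. r \<noteq> 0 \<and> A1 E U *v r = lam U *s (A0 U *v r) \<longrightarrow> frechet_derivative lam (at U) r \<noteq> 0))"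

text \<open>An entropy \<open>\<eta>\<close> with flux \<open>q\<close>: smooth solutions satisfy \<open>\<eta>\<^sub>t + q\<^sub>x = 0\<close>.\<close>

definition entropy_pair ::
    "(real \<Rightarrow> real \<Rightarrow> real) \<Rightarrow> (real ^ 3 \<Rightarrow> real) \<Rightarrow> (real ^ 3 \<Rightarrow> real) \<Rightarrow> bool" where
  "entropy_pair E \<eta> q \<longleftrightarrow>
     (\<forall>U\<in>states. \<eta> differentiable (at U) \<and> q differentiable (at U) \<and>
        (\<forall>h. frechet_derivative \<eta> (at U) (matrix_inv (A0 U) *v (A1 E U *v h))
              = frechet_derivative q (at U) h))"


section \<open>Lax shocks and Hugoniot curves\<close>

definition rankine_hugoniot ::
    "(real \<Rightarrow> real \<Rightarrow> real) \<Rightarrow> real ^ 3 \<Rightarrow> real ^ 3 \<Rightarrow> real \<Rightarrow> bool" where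
  "rankine_hugoniot E Um Up \<sigma> \<longleftrightarrow> \<sigma> *s (f0 Up - f0 Um) = f1 E Up - f1 E Um"

text \<open>Only the families \<open>k = 1\<close> and \<open>k = 3\<close> carry shocks.\<close>

definition lax_shock ::
    "(real \<Rightarrow> real \<Rightarrow> real) \<Rightarrow> nat \<Rightarrow> real ^ 3 \<Rightarrow> real ^ 3 \<Rightarrow> real \<Rightarrow> bool" where
  "lax_shock E k Um Up \<sigma> \<longleftrightarrow>
     Um \<in> states \<and> Up \<in> states \<and> rankine_hugoniot E Um Up \<sigma> \<and>
     (k = 1 \<and> \<sigma> < - sound_speed E Um \<and> - sound_speed E Up < \<sigma> \<and> \<sigma> < 0 \<or>
      k = 3 \<and> 0 < \<sigma> \<and> \<sigma> < sound_speed E Um \<and> sound_speed E Up < \<sigma>)"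

definition forward_hugoniot ::
    "(real \<Rightarrow> real \<Rightarrow> real) \<Rightarrow> nat \<Rightarrow> real ^ 3 \<Rightarrow> (real ^ 3) set" where
  "forward_hugoniot E k Um = {Up. \<exists>\<sigma>. lax_shock E k Um Up \<sigma>}"

text \<open>\<open>\<gamma>\<close> parametrizes the forward \<open>k\<close>-Hugoniot curve, which emanates from \<open>Um\<close>
  (\<open>Um\<close> itself is not on it), and \<open>s\<close> is the shock speed along it.\<close>

definition hugoniot_parametrization ::
    "(real \<Rightarrow> real \<Rightarrow> real) \<Rightarrow> nat \<Rightarrow> real ^ 3 \<Rightarrow> (real \<Rightarrow> real ^ 3) \<Rightarrow> (real \<Rightarrow> real) \<Rightarrow> bool" where
  "hugoniot_parametrization E k Um \<gamma> s \<longleftrightarrow>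
     continuous_on {0<..<1} \<gamma> \<and> bij_betw \<gamma> {0<..<1} (forward_hugoniot E k Um) \<and>
     (\<gamma> \<longlongrightarrow> Um) (at_right 0) \<and> (\<forall>\<alpha>\<in>{0<..<1}. lax_shock E k Um (\<gamma> \<alpha>) (s \<alpha>))"

definition strictly_monotone_on :: "real set \<Rightarrow> (real \<Rightarrow> real) \<Rightarrow> bool" where
  "strictly_monotone_on I f \<longleftrightarrow> strict_mono_on I f \<or> strict_antimono_on I f"

definition monotone_along_hugoniot :: "(real \<Rightarrow> real \<Rightarrow> real) \<Rightarrow> nat \<Rightarrow> bool" where
  "monotone_along_hugoniot E k \<longleftrightarrow>
     (\<forall>Um\<in>states. \<exists>\<gamma> s. hugoniot_parametrization E k Um \<gamma> s \<and>
        strictly_monotone_on {0<..<1} (\<lambda>\<alpha>. S_state E (\<gamma> \<alpha>)) \<and>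
        strictly_monotone_on {0<..<1} s)"


section \<open>Lopatinski determinant and inviscid stability\<close>

definition r1 :: "(real \<Rightarrow> real \<Rightarrow> real) \<Rightarrow> real ^ 3 \<Rightarrow> real ^ 3" where
  "r1 E U = vector [1, sound_speed E U, - p_state E U]"

definition r2 :: "(real \<Rightarrow> real \<Rightarrow> real) \<Rightarrow> real ^ 3 \<Rightarrow> real ^ 3" where
  "r2 E U = vector [- pd2 (p_hat E) (U $ 1) (U $ 3), 0, pd1 (p_hat E) (U $ 1) (U $ 3)]"

definition r3 :: "(real \<Rightarrow> real \<Rightarrow> real) \<Rightarrow> real ^ 3 \<Rightarrow> real ^ 3" where
  "r3 E U = vector [1, - sound_speed E U, - p_state E U]"

definition det_columns :: "real ^ 3 \<Rightarrow> real ^ 3 \<Rightarrow> real ^ 3 \<Rightarrow> real" where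
  "det_columns a b c = det (transpose (vector [a, b, c] :: real ^ 3 ^ 3))"

definition lopatinski ::
    "(real \<Rightarrow> real \<Rightarrow> real) \<Rightarrow> nat \<Rightarrow> real ^ 3 \<Rightarrow> real ^ 3 \<Rightarrow> real" where
  "lopatinski E k Um Up =
     (if k = 1 then det_columns (f0 Up - f0 Um) (A0 Up *v r2 E Up) (A0 Up *v r3 E Up)
      else det_columns (A0 Um *v r1 E Um) (A0 Um *v r2 E Um) (f0 Up - f0 Um))"

definition shock_path ::
    "(real \<Rightarrow> real \<Rightarrow> real) \<Rightarrow> nat \<Rightarrow> real ^ 3 \<Rightarrow> real ^ 3
       \<Rightarrow> (real \<Rightarrow> real ^ 3) \<Rightarrow> (real \<Rightarrow> real ^ 3) \<Rightarrow> bool" where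
  "shock_path E k Um Up Vm Vp \<longleftrightarrow>
     continuous_on {0<..1} Vm \<and> continuous_on {0<..1} Vp \<and>
     (\<forall>\<alpha>\<in>{0<..1}. \<exists>\<sigma>. lax_shock E k (Vm \<alpha>) (Vp \<alpha>) \<sigma>) \<and>
     Vm 1 = Um \<and> Vp 1 = Up \<and>
     (\<exists>Us\<in>states. (Vm \<longlongrightarrow> Us) (at_right 0) \<and> (Vp \<longlongrightarrow> Us) (at_right 0))"

definition signed_lopatinski_along ::
    "(real \<Rightarrow> real \<Rightarrow> real) \<Rightarrow> nat \<Rightarrow> (real \<Rightarrow> real ^ 3) \<Rightarrow> (real \<Rightarrow> real ^ 3) \<Rightarrow> real \<Rightarrow> bool" where
  "signed_lopatinski_along E k Vm Vp \<Delta> \<longleftrightarrow>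
     (\<exists>l. l \<noteq> 0 \<and> ((\<lambda>\<alpha>. sgn (lopatinski E k (Vm \<alpha>) (Vp \<alpha>))) \<longlongrightarrow> l) (at_right 0) \<and>
          \<Delta> = lopatinski E k (Vm 1) (Vp 1) / l)"

text \<open>Since the sign of the signed determinant does not depend on the path, instability is required
  along every path, together with the existence of one.\<close>

definition inviscidly_unstable ::
    "(real \<Rightarrow> real \<Rightarrow> real) \<Rightarrow> nat \<Rightarrow> real ^ 3 \<Rightarrow> real ^ 3 \<Rightarrow> bool" where
  "inviscidly_unstable E k Um Up \<longleftrightarrow>
     (\<exists>Vm Vp. shock_path E k Um Up Vm Vp) \<and>
     (\<forall>Vm Vp. shock_path E k Um Up Vm Vp \<longrightarrow> (\<exists>\<Delta><0. signed_lopatinski_along E k Vm Vp \<Delta>))"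


section \<open>The structural conditions\<close>

definition energy_conditions :: "(real \<Rightarrow> real \<Rightarrow> real) \<Rightarrow> bool" where
  "energy_conditions E \<longleftrightarrow>
     (\<forall>\<tau>>0. \<forall>S. E \<tau> S > 0 \<and> pressure E \<tau> S > 0 \<and> temperature E \<tau> S > 0 \<and>
        pd1 (pressure E) \<tau> S < 0 \<and> pd1 (pd1 (pressure E)) \<tau> S > 0 \<and> pd2 (pressure E) \<tau> S > 0)"

definition pressure_law_conditions :: "(real \<Rightarrow> real \<Rightarrow> real) \<Rightarrow> bool" where
  "pressure_law_conditions E \<longleftrightarrow>
     (\<forall>\<tau>>0. \<forall>e>0. p_hat E \<tau> e > 0 \<and> isentropic_deriv E (p_hat E) \<tau> e < 0 \<and>
        isentropic_deriv E (isentropic_deriv E (p_hat E)) \<tau> e > 0 \<and> pd2 (p_hat E) \<tau> e > 0)"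

definition entropy_limits :: "(real \<Rightarrow> real \<Rightarrow> real) \<Rightarrow> bool" where
  "entropy_limits E \<longleftrightarrow>
     (\<forall>\<tau>>0. ((\<lambda>S. E \<tau> S) \<longlongrightarrow> 0) at_bot \<and> filterlim (\<lambda>S. E \<tau> S) at_top at_top \<and>
        ((\<lambda>S. - pd1 E \<tau> S) \<longlongrightarrow> 0) at_bot \<and> filterlim (\<lambda>S. - pd1 E \<tau> S) at_top at_top)"

definition volume_limits :: "(real \<Rightarrow> real \<Rightarrow> real) \<Rightarrow> bool" where
  "volume_limits E \<longleftrightarrow>
     (\<forall>p>0. ((\<lambda>\<tau>. e_check E \<tau> p) \<longlongrightarrow> 0) (at_right 0)) \<and>
     (\<forall>S. ((\<lambda>\<tau>. E \<tau> S) \<longlongrightarrow> 0) at_top)"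

definition extreme_fields_nondegenerate :: "(real \<Rightarrow> real \<Rightarrow> real) \<Rightarrow> bool" where
  "extreme_fields_nondegenerate E \<longleftrightarrow>
     (\<forall>lam \<in> {\<lambda>U. Max (char_speeds E U), \<lambda>U. Min (char_speeds E U)}.
        simple_speed E lam \<and> genuinely_nonlinear E lam)"

definition global_concave_entropy :: "(real \<Rightarrow> real \<Rightarrow> real) \<Rightarrow> bool" where
  "global_concave_entropy E \<longleftrightarrow>
     (\<forall>\<tau>>0. \<forall>e>0. \<exists>!S. E \<tau> S = e) \<and>
     entropy_pair E (S_state E) (\<lambda>U. 0) \<and>
     concave_on ({0<..} \<times> {0<..}) (\<lambda>(\<tau>, e). S_hat E \<tau> e)"

definition structural_conditions :: "(real \<Rightarrow> real \<Rightarrow> real) \<Rightarrow> bool" where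
  "structural_conditions E \<longleftrightarrow>
     energy_conditions E \<and> pressure_law_conditions E \<and> entropy_limits E \<and> volume_limits E \<and>
     extreme_fields_nondegenerate E \<and>
     monotone_along_hugoniot E 1 \<and> monotone_along_hugoniot E 3 \<and>
     global_concave_entropy E"

definition admits_unstable_shocks :: "(real \<Rightarrow> real \<Rightarrow> real) \<Rightarrow> bool" where
  "admits_unstable_shocks E \<longleftrightarrow>
     (\<exists>k\<in>{1, 3}. \<exists>Um Up. (\<exists>\<sigma>. lax_shock E k Um Up \<sigma>) \<and> inviscidly_unstable E k Um Up)"

definition example_eos :: "real \<Rightarrow> real \<Rightarrow> real \<Rightarrow> real" where
  "example_eos C \<tau> S = exp S / \<tau> + C\<^sup>2 * exp (S / C\<^sup>2 - \<tau> / C)"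

end

theory Submission
  imports Defs
begin

text \<open>Convexity of the energy and of its isentropes determines which shocks exist and how their entropy and
speed vary, but inviscid stability of a shock also depends on the size of the pressure jump relative
to the thermodynamic coefficients behind it, and that ratio can be made large without disturbing
any of the convexity.

\<^emph>\<open>Structure.\<close>  Let \<open>E\<close> be jointly convex and satisfy the sign conditions and the limits.  Then
\<open>(\<tau>, S) \<mapsto> (\<tau>, E \<tau> S)\<close> is invertible, and because \<open>\<partial>\<^sub>\<tau> - p \<partial>\<^sub>e\<close> is differentiation along isentropes,
every statement about \<open>p_hat\<close> reduces to a sign of a derivative of \<open>E\<close>.  Convexity of \<open>E\<close> and \<open>T > 0\<close> make
the entropy concave, and genuine nonlinearity of the acoustic fields is \<open>p\<^sub>\<tau>\<^sub>\<tau> > 0\<close>.  The shock curves need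
a global argument.  Fix one end state \<open>(\<tau>0, S0)\<close> of a shock and a slope \<open>m\<close>, and set
\<open>G \<tau> S = E \<tau> S - E \<tau>0 S0 + p0 (\<tau> - \<tau>0) - (m/2) (\<tau> - \<tau>0)\<^sup>2\<close>.  Its derivative in \<open>\<tau>\<close> is the gap between
the Rayleigh line of slope \<open>- m\<close> and the isentrope, its derivative in \<open>S\<close> is \<open>T > 0\<close>, and at a state of the
Hugoniot curve with \<open>\<sigma>\<^sup>2 = - [p]/[\<tau>]\<close> it equals \<open>(\<sigma>\<^sup>2 - m) (\<tau> - \<tau>0)\<^sup>2 / 2\<close>.  Since isentropes are
strictly convex, the signs of the gap are known, so comparing \<open>G\<close> along isentropes yields the Lax
inequalities (\<open>speed_sq_between_sound_speeds\<close>), the fact that Lax shocks are compressive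
(\<open>lax_imp_compressive\<close>) and the monotonicity of the speed (\<open>speed_sq_mono_compressed\<close>,
\<open>speed_sq_mono_expanded\<close>).  On the isentropes \<open>S > S0\<close> for \<open>\<tau> < \<tau>0\<close>, and on \<open>S < S0\<close> for \<open>\<tau> > \<tau>0\<close>, the Hugoniot function is strictly
increasing in \<open>\<tau>\<close> at each of its zeros; hence every
\<open>S > S0\<close> has exactly one compressed state and every \<open>S < S0\<close> exactly one expanded state: entropy
is a global parameter, continuous through \<open>S0\<close>.  The half \<open>S > S0\<close> is the forward curve of 1-shocks and the
half \<open>S < S0\<close> that of 3-shocks.

\<^emph>\<open>Instability.\<close>  For a 3-shock the Lopatinski determinant factors (\<open>lopatinski_3\<close>) as
\<open>c [\<tau>] ((p\<^sub>- - p\<^sub>+) p\<^sub>e - c\<^sup>2 - c \<sigma>)\<close> with \<open>c\<close> and \<open>p\<^sub>e\<close> taken at the compressed state.  It is negative for weak shocks,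
as \<open>p\<^sub>- - p\<^sub>+\<close> tends to \<open>0\<close>.  Along the 3-curve \<open>p\<^sub>+\<close> tends to \<open>0\<close>, and \<open>\<sigma> < c\<close>, so that as soon as
\<open>p p\<^sub>e > 2 c\<^sup>2\<close> at one state, sufficiently strong shocks issuing from it have the opposite sign
(\<open>strong_shock_unstable\<close>).

\<^emph>\<open>Example.\<close>  The two terms of the example are \<open>exp\<close> of convex functions of \<open>(\<tau>, S)\<close>.  At \<open>\<tau> = 1\<close>, \<open>S = 0\<close> the
pressure is about \<open>C\<close>, while \<open>p\<^sub>S\<close>, \<open>T\<close> and \<open>c\<^sup>2\<close> stay bounded away from \<open>0\<close> and \<open>\<infinity>\<close>, so that the criterion
holds for large \<open>C\<close>.\<close>

section \<open>Calculus in two real variables\<close>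

lemma pd_has_derivative:
  assumes "((\<lambda>z. f (fst z) (snd z)) has_derivative (\<lambda>h. a * fst h + b * snd h)) (at (x, y))"
  shows "((\<lambda>t. f t y) has_real_derivative a) (at x)"
    and "((\<lambda>t. f x t) has_real_derivative b) (at y)"
    and "pd1 f x y = a" and "pd2 f x y = b"
proof -
  have "((\<lambda>t. (t, y)) has_derivative (\<lambda>h. (h, 0))) (at x)"
    by (intro derivative_eq_intros) auto
  from has_derivative_compose[OF this assms]
  show 1: "((\<lambda>t. f t y) has_real_derivative a) (at x)"
    by (simp add: has_field_derivative_def mult_commute_abs)
  have "((\<lambda>t. (x, t)) has_derivative (\<lambda>h. (0, h))) (at y)"
    by (intro derivative_eq_intros) auto
  from has_derivative_compose[OF this assms]
  show 2: "((\<lambda>t. f x t) has_real_derivative b) (at y)"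
    by (simp add: has_field_derivative_def mult_commute_abs)
  show "pd1 f x y = a" "pd2 f x y = b"
    using 1 2 by (simp_all add: pd1_def pd2_def DERIV_imp_deriv)
qed

text \<open>This turns the bare differentiability in the definition of \<open>C_k_on\<close> into a formula for the derivative.\<close>

lemma differentiable_imp_has_derivative_pd:
  assumes "(\<lambda>(x, y). f x y) differentiable (at (x, y))"
  shows "((\<lambda>z. f (fst z) (snd z)) has_derivative (\<lambda>h. pd1 f x y * fst h + pd2 f x y * snd h)) (at (x, y))"
proof -
  obtain D where D: "((\<lambda>z. f (fst z) (snd z)) has_derivative D) (at (x, y))"
    using assms by (auto simp: differentiable_def case_prod_beta')
  then have lin: "linear D" by (rule has_derivative_linear)
  have "D h = D (1, 0) * fst h + D (0, 1) * snd h" for h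
  proof -
    have "h = fst h *\<^sub>R (1, 0) + snd h *\<^sub>R (0, 1)" by (cases h) simp
    then have "D h = D (fst h *\<^sub>R (1, 0) + snd h *\<^sub>R (0, 1))" by simp
    also have "\<dots> = D (1, 0) * fst h + D (0, 1) * snd h"
      by (simp add: linear_add[OF lin] linear_scale[OF lin] del: scaleR_Pair)
    finally show ?thesis .
  qed
  then have "D = (\<lambda>h. D (1, 0) * fst h + D (0, 1) * snd h)" by (rule ext)
  with D have D': "((\<lambda>z. f (fst z) (snd z)) has_derivative
      (\<lambda>h. D (1, 0) * fst h + D (0, 1) * snd h)) (at (x, y))" by simp
  have "pd1 f x y = D (1, 0)" "pd2 f x y = D (0, 1)"
    using pd_has_derivative(3,4)[where f = f, OF D'] .
  with D' show ?thesis by simp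
qed

lemma pd_cong_open:
  assumes "open D" "(x, y) \<in> D" and eq: "\<And>x y. (x, y) \<in> D \<Longrightarrow> f x y = g x y"
  shows "pd1 f x y = pd1 g x y" "pd2 f x y = pd2 g x y"
proof -
  have 1: "open ((\<lambda>t. (t, y)) -` D)" "open ((\<lambda>t. (x, t)) -` D)"
    by (intro open_vimage assms continuous_intros)+
  have "\<forall>\<^sub>F t in nhds x. f t y = g t y"
    using eventually_nhds_in_open[OF 1(1), of x] assms(2) by (auto elim!: eventually_mono intro: eq)
  then show "pd1 f x y = pd1 g x y" unfolding pd1_def by (intro deriv_cong_ev) auto
  have "\<forall>\<^sub>F t in nhds y. f x t = g x t"
    using eventually_nhds_in_open[OF 1(2), of y] assms(2) by (auto elim!: eventually_mono intro: eq)
  then show "pd2 f x y = pd2 g x y" unfolding pd2_def by (intro deriv_cong_ev) auto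
qed

text \<open>Partial derivatives at a point of an open set see the function only near that point; hence closed formulas that are valid for positive volume suffice.\<close>

lemma C_k_on_cong_open:
  assumes "open D" "C_k_on k D f" and "\<And>x y. (x, y) \<in> D \<Longrightarrow> f x y = g x y"
  shows "C_k_on k D g"
  using assms(2,3)
proof (induction k arbitrary: f g)
  case 0
  then have "continuous_on D (\<lambda>(x, y). f x y)" by simp
  moreover have "(case z of (x, y) \<Rightarrow> f x y) = (case z of (x, y) \<Rightarrow> g x y)" if "z \<in> D" for z
    using 0(2) that by (cases z) simp
  ultimately have "continuous_on D (\<lambda>(x, y). g x y)" by (rule continuous_on_eq)
  then show ?case by simp
next
  case (Suc k)
  have "(\<lambda>(x, y). g x y) differentiable (at z)" if "z \<in> D" for z
  proof -
    have "(\<lambda>(x, y). f x y) differentiable (at z)" using Suc.prems(1) that by simp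
    then obtain F where "((\<lambda>(x, y). f x y) has_derivative F) (at z)"
      unfolding differentiable_def by (rule exE)
    then have "((\<lambda>(x, y). g x y) has_derivative F) (at z)"
      by (rule has_derivative_transform_within_open[OF _ assms(1) that]) (auto simp: Suc.prems(2))
    then show ?thesis by (auto simp: differentiable_def)
  qed
  moreover have "C_k_on k D (pd1 g)" "C_k_on k D (pd2 g)"
    using Suc.IH[of "pd1 f" "pd1 g"] Suc.IH[of "pd2 f" "pd2 g"] Suc.prems(1)
      pd_cong_open[OF assms(1) _ Suc.prems(2)] by simp_all
  ultimately show ?case by simp
qed

lemma open_domain: "open ({0<..} \<times> (UNIV :: real set) :: (real \<times> real) set)"
  by (intro open_Times) auto

lemma smooth_eos_has_derivative:
  assumes "smooth_eos f" "x > 0"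
  shows "((\<lambda>z. f (fst z) (snd z)) has_derivative (\<lambda>h. pd1 f x y * fst h + pd2 f x y * snd h)) (at (x, y))"
proof -
  have "C_k_on (Suc 0) ({0<..} \<times> UNIV) f" using assms(1) unfolding smooth_eos_def by blast
  with assms(2) show ?thesis by (intro differentiable_imp_has_derivative_pd) auto
qed

lemma smooth_eos_pd:
  assumes "smooth_eos f" shows "smooth_eos (pd1 f)" "smooth_eos (pd2 f)"
proof -
  have "C_k_on (Suc k) ({0<..} \<times> UNIV) f" for k using assms unfolding smooth_eos_def by blast
  then show "smooth_eos (pd1 f)" "smooth_eos (pd2 f)" unfolding smooth_eos_def by auto
qed

lemma C_k_on_uminus:
  assumes "open D" "C_k_on k D f" shows "C_k_on k D (\<lambda>x y. - f x y)"
  using assms(2)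
proof (induction k arbitrary: f)
  case 0
  then show ?case using continuous_on_minus[of D "\<lambda>(x, y). f x y"] by (simp add: case_prod_beta')
next
  case (Suc k)
  have hd: "((\<lambda>z. - f (fst z) (snd z)) has_derivative
      (\<lambda>h. (- pd1 f x y) * fst h + (- pd2 f x y) * snd h)) (at (x, y))" if "(x, y) \<in> D" for x y
    using differentiable_imp_has_derivative_pd[of f x y] Suc.prems that
    by (auto intro!: derivative_eq_intros)
  have "(\<lambda>(x, y). - f x y) differentiable (at z)" if "z \<in> D" for z
    using hd[of "fst z" "snd z"] that by (auto simp: differentiable_def case_prod_beta')
  moreover have "C_k_on k D (pd1 (\<lambda>x y. - f x y))"
  proof (rule C_k_on_cong_open[OF assms(1)])
    show "C_k_on k D (\<lambda>x y. - pd1 f x y)" using Suc by (intro Suc.IH) simp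
  qed (rule pd_has_derivative(3)[where f = "\<lambda>x y. - f x y", OF hd, symmetric])
  moreover have "C_k_on k D (pd2 (\<lambda>x y. - f x y))"
  proof (rule C_k_on_cong_open[OF assms(1)])
    show "C_k_on k D (\<lambda>x y. - pd2 f x y)" using Suc by (intro Suc.IH) simp
  qed (rule pd_has_derivative(4)[where f = "\<lambda>x y. - f x y", OF hd, symmetric])
  ultimately show ?case by simp
qed

lemma smooth_eos_uminus: "smooth_eos f \<Longrightarrow> smooth_eos (\<lambda>x y. - f x y)"
  unfolding smooth_eos_def using C_k_on_uminus[OF open_domain] by blast

section \<open>Thermodynamics of an equation of state\<close>

text \<open>The conditions under which the entropy is a function of volume and pressure.  They stand apart from the limit of \<open>e_check\<close>, because that limit is meaningful, and can be verified for an example, only once this function exists.\<close>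

locale equation_of_state =
  fixes E :: "real \<Rightarrow> real \<Rightarrow> real"
  assumes smooth: "smooth_eos E"
    and energy: "energy_conditions E"
    and at_entropy_ends: "entropy_limits E"
begin

abbreviation "P \<equiv> pressure E"
abbreviation "T \<equiv> temperature E"
text \<open>The squared sound speed \<open>c\<^sup>2 = - p\<^sub>\<tau>\<close> as a function of volume and entropy.\<close>

definition "Q \<tau> S = - pd1 (pressure E) \<tau> S"

lemma signs:
  assumes "\<tau> > 0"
  shows "E \<tau> S > 0" "P \<tau> S > 0" "T \<tau> S > 0" "Q \<tau> S > 0"
    "pd1 Q \<tau> S < 0" "pd2 P \<tau> S > 0"
proof -
  show "E \<tau> S > 0" "P \<tau> S > 0" "T \<tau> S > 0" "Q \<tau> S > 0" "pd2 P \<tau> S > 0"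
    using energy assms unfolding energy_conditions_def Q_def by simp_all
  have "smooth_eos (pd1 P)"
    using smooth unfolding pressure_def[abs_def] by (intro smooth_eos_pd smooth_eos_uminus)
  from smooth_eos_has_derivative[OF this assms, of S]
  have "((\<lambda>z. Q (fst z) (snd z)) has_derivative
      (\<lambda>h. (- pd1 (pd1 P) \<tau> S) * fst h + (- pd2 (pd1 P) \<tau> S) * snd h)) (at (\<tau>, S))"
    unfolding Q_def by (auto intro!: derivative_eq_intros)
  then have "pd1 Q \<tau> S = - pd1 (pd1 P) \<tau> S" by (rule pd_has_derivative(3)[where f = Q])
  moreover have "pd1 (pd1 P) \<tau> S > 0" using energy assms unfolding energy_conditions_def by blast
  ultimately show "pd1 Q \<tau> S < 0" by linarith
qed

lemma smooth_P: "smooth_eos P" and smooth_Q: "smooth_eos Q" and smooth_T: "smooth_eos T"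
proof -
  show 1: "smooth_eos P"
    using smooth unfolding pressure_def[abs_def] by (intro smooth_eos_pd smooth_eos_uminus)
  then show "smooth_eos Q" unfolding Q_def[abs_def] by (intro smooth_eos_pd smooth_eos_uminus)
  show "smooth_eos T" using smooth unfolding temperature_def[abs_def] by (intro smooth_eos_pd)
qed

lemma E_has_derivative:
  "\<tau> > 0 \<Longrightarrow> ((\<lambda>z. E (fst z) (snd z)) has_derivative (\<lambda>h. - P \<tau> S * fst h + T \<tau> S * snd h)) (at (\<tau>, S))"
  using smooth_eos_has_derivative[OF smooth, of \<tau> S] by (simp add: pressure_def temperature_def)

lemma P_has_derivative:
  "\<tau> > 0 \<Longrightarrow> ((\<lambda>z. P (fst z) (snd z)) has_derivative (\<lambda>h. - Q \<tau> S * fst h + pd2 P \<tau> S * snd h)) (at (\<tau>, S))"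
  using smooth_eos_has_derivative[OF smooth_P, of \<tau> S] by (simp add: Q_def)

lemmas E_deriv_volume = pd_has_derivative(1)[where f = E, OF E_has_derivative]
  and E_deriv_entropy = pd_has_derivative(2)[where f = E, OF E_has_derivative]
  and P_deriv_volume = pd_has_derivative(1)[where f = P, OF P_has_derivative]
  and P_deriv_entropy = pd_has_derivative(2)[where f = P, OF P_has_derivative]
  and Q_deriv_volume = pd_has_derivative(1)[where f = Q, OF smooth_eos_has_derivative[OF smooth_Q]]

lemma E_less_iff: "\<tau> > 0 \<Longrightarrow> E \<tau> S < E \<tau> S' \<longleftrightarrow> S < S'"
proof -
  assume \<tau>: "\<tau> > 0"
  have "strict_mono (E \<tau>)"
  proof (rule strict_monoI)
    fix a b :: real
    assume "a < b"
    then show "E \<tau> a < E \<tau> b"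
      by (rule DERIV_pos_imp_increasing) (use E_deriv_entropy[OF \<tau>] signs(3)[OF \<tau>] in blast)
  qed
  then show ?thesis by (simp add: strict_mono_less)
qed

lemma P_less_iff: "\<tau> > 0 \<Longrightarrow> P \<tau> S < P \<tau> S' \<longleftrightarrow> S < S'"
proof -
  assume \<tau>: "\<tau> > 0"
  have "strict_mono (P \<tau>)"
  proof (rule strict_monoI)
    fix a b :: real
    assume "a < b"
    then show "P \<tau> a < P \<tau> b"
      by (rule DERIV_pos_imp_increasing) (use P_deriv_entropy[OF \<tau>] signs(6)[OF \<tau>] in blast)
  qed
  then show ?thesis by (simp add: strict_mono_less)
qed

lemma Q_antimono:
  assumes "a < b" "0 < a"
  shows "Q b S < Q a S"
proof (rule DERIV_neg_imp_decreasing[where f = "\<lambda>t. Q t S", OF assms(1)])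
  fix x assume "a \<le> x"
  then have "x > 0" using assms(2) by simp
  with Q_deriv_volume signs(5) show "\<exists>y. ((\<lambda>t. Q t S) has_real_derivative y) (at x) \<and> y < 0"
    by blast
qed

lemma P_antimono:
  assumes "a < b" "0 < a"
  shows "P b S < P a S"
proof (rule DERIV_neg_imp_decreasing[where f = "\<lambda>t. P t S", OF assms(1)])
  fix x assume "a \<le> x"
  then have "x > 0" using assms(2) by simp
  with P_deriv_volume signs(4) show "\<exists>y. ((\<lambda>t. P t S) has_real_derivative y) (at x) \<and> y < 0"
    by (meson neg_less_0_iff_less)
qed

text \<open>Strict convexity of isentropes in the \<open>(\<tau>, p)\<close>-plane, in the form in which shocks use it.\<close>

lemma isentrope_above_tangent:
  assumes "a > 0" "t > 0" "t \<noteq> a"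
  shows "P t S > P a S - Q a S * (t - a)"
proof -
  define g where "g t = P t S + Q a S * (t - a)" for t
  have g: "(g has_real_derivative (Q a S - Q t S)) (at t)" if "t > 0" for t
    unfolding g_def by (rule derivative_eq_intros P_deriv_volume that refl | simp)+
  have "g a < g t"
  proof (cases "t < a")
    case True
    then obtain z where z: "t < z" "z < a" "g a - g t = (a - t) * (Q a S - Q z S)"
      using MVT2[of t a g "\<lambda>t. Q a S - Q t S"] g assms by force
    moreover have "Q a S < Q z S" using z assms by (intro Q_antimono) auto
    ultimately show ?thesis using True by (smt (verit) mult_pos_neg)
  next
    case False
    then obtain z where z: "a < z" "z < t" "g t - g a = (t - a) * (Q a S - Q z S)"
      using MVT2[of a t g "\<lambda>t. Q a S - Q t S"] g assms by force
    moreover have "Q z S < Q a S" using z assms by (intro Q_antimono) auto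
    ultimately show ?thesis using False assms by (smt (verit) mult_pos_pos)
  qed
  then show ?thesis by (simp add: g_def)
qed

text \<open>Solvability of \<open>p = - E\<^sub>\<tau>(\<tau>, S)\<close> for the entropy: the limits in \<open>S\<close> give existence, \<open>p\<^sub>S > 0\<close> uniqueness.\<close>

lemma ex1_pressure: assumes "\<tau> > 0" "p > 0" shows "\<exists>!S. P \<tau> S = p"
proof (rule ex_ex1I)
  have lim: "((\<lambda>S. P \<tau> S) \<longlongrightarrow> 0) at_bot" "filterlim (\<lambda>S. P \<tau> S) at_top at_top"
    using at_entropy_ends assms(1) by (auto simp: entropy_limits_def pressure_def)
  obtain a where a: "P \<tau> a < p"
    using order_tendstoD(2)[OF lim(1) assms(2)] eventually_happens' trivial_limit_at_bot_linorder by blast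
  obtain b where b: "P \<tau> b > p"
    using filterlim_at_top_dense[THEN iffD1, OF lim(2)] eventually_happens' trivial_limit_at_top_linorder by blast
  have "a < b" using a b P_less_iff[OF assms(1)] by (smt (verit))
  then show "\<exists>S. P \<tau> S = p"
    using IVT[of "P \<tau>" a p b] a b DERIV_isCont[OF P_deriv_entropy[OF assms(1)]] by force
  show "\<And>S S'. P \<tau> S = p \<Longrightarrow> P \<tau> S' = p \<Longrightarrow> S = S'"
    using P_less_iff[OF assms(1)] by (metis linorder_neqE less_irrefl)
qed

lemma P_S_check: "\<tau> > 0 \<Longrightarrow> p > 0 \<Longrightarrow> P \<tau> (S_check E \<tau> p) = p"
  unfolding S_check_def using ex1_pressure by (rule theI')

section \<open>Rayleigh lines and the Hugoniot relation\<close>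

text \<open>The height of the Rayleigh line through \<open>(\<tau>0, P \<tau>0 S0)\<close> with slope \<open>- m\<close> above the isentrope of entropy \<open>S\<close>.\<close>

definition rayleigh_gap :: "real \<Rightarrow> real \<Rightarrow> real \<Rightarrow> real \<Rightarrow> real \<Rightarrow> real" where
  "rayleigh_gap m \<tau>0 S0 \<tau> S = P \<tau>0 S0 - m * (\<tau> - \<tau>0) - P \<tau> S"

text \<open>The function \<open>G\<close> of the opening explanation: the energy balance of a shock with the pressure jump replaced by its value on the Rayleigh line, so that \<open>\<tau>\<close>-derivatives involve only the gap.\<close>

definition rayleigh_potential :: "real \<Rightarrow> real \<Rightarrow> real \<Rightarrow> real \<Rightarrow> real \<Rightarrow> real" where
  "rayleigh_potential m \<tau>0 S0 \<tau> S =
     E \<tau> S - E \<tau>0 S0 + P \<tau>0 S0 * (\<tau> - \<tau>0) - m / 2 * (\<tau> - \<tau>0)\<^sup>2"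

definition hugoniot :: "real \<Rightarrow> real \<Rightarrow> real \<Rightarrow> real \<Rightarrow> real" where
  "hugoniot \<tau>0 S0 \<tau> S = E \<tau> S - E \<tau>0 S0 + (P \<tau> S + P \<tau>0 S0) / 2 * (\<tau> - \<tau>0)"

text \<open>For states that satisfy the Rankine-Hugoniot conditions this is \<open>\<sigma>\<^sup>2\<close>; geometrically, minus the slope of the chord in the \<open>(\<tau>, p)\<close>-plane.\<close>

definition speed_sq :: "real \<Rightarrow> real \<Rightarrow> real \<Rightarrow> real \<Rightarrow> real" where
  "speed_sq \<tau>0 S0 \<tau> S = - (P \<tau> S - P \<tau>0 S0) / (\<tau> - \<tau>0)"

lemma hugoniot_sym: "hugoniot \<tau>0 S0 \<tau> S = - hugoniot \<tau> S \<tau>0 S0"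
  by (simp add: hugoniot_def field_simps)

lemma speed_sq_sym: "speed_sq \<tau>0 S0 \<tau> S = speed_sq \<tau> S \<tau>0 S0"
  unfolding speed_sq_def by (metis minus_diff_eq minus_divide_divide)

text \<open>The key identity.  It converts a comparison of shock speeds into the sign of the potential.\<close>

lemma rayleigh_potential_on_hugoniot:
  assumes "hugoniot \<tau>0 S0 \<tau> S = 0" "\<tau> \<noteq> \<tau>0"
  shows "rayleigh_potential m \<tau>0 S0 \<tau> S = (speed_sq \<tau>0 S0 \<tau> S - m) / 2 * (\<tau> - \<tau>0)\<^sup>2"
proof -
  have *: "P \<tau> S - P \<tau>0 S0 = - speed_sq \<tau>0 S0 \<tau> S * (\<tau> - \<tau>0)"
    using assms(2) by (simp add: speed_sq_def)
  have "rayleigh_potential m \<tau>0 S0 \<tau> S = hugoniot \<tau>0 S0 \<tau> S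
      - (P \<tau> S - P \<tau>0 S0) / 2 * (\<tau> - \<tau>0) - m / 2 * (\<tau> - \<tau>0)\<^sup>2"
    by (simp add: rayleigh_potential_def hugoniot_def field_simps)
  then show ?thesis unfolding * assms(1) by (simp add: field_simps power2_eq_square)
qed

lemma rayleigh_gap_speed_sq: "\<tau> \<noteq> \<tau>0 \<Longrightarrow> rayleigh_gap (speed_sq \<tau>0 S0 \<tau> S) \<tau>0 S0 \<tau> S = 0"
  by (simp add: rayleigh_gap_def speed_sq_def)

lemma rayleigh_potential_deriv:
  "\<tau> > 0 \<Longrightarrow> ((\<lambda>t. rayleigh_potential m \<tau>0 S0 t S) has_real_derivative rayleigh_gap m \<tau>0 S0 \<tau> S) (at \<tau>)"
  unfolding rayleigh_potential_def
  by (rule derivative_eq_intros E_deriv_volume refl | simp add: rayleigh_gap_def algebra_simps)+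

lemma rayleigh_potential_less_iff:
  "\<tau> > 0 \<Longrightarrow> rayleigh_potential m \<tau>0 S0 \<tau> S < rayleigh_potential m \<tau>0 S0 \<tau> S' \<longleftrightarrow> S < S'"
  by (simp add: rayleigh_potential_def E_less_iff)

lemma rayleigh_potential_increasing:
  assumes "0 < a" "a < b" "\<And>t. a < t \<Longrightarrow> t < b \<Longrightarrow> rayleigh_gap m \<tau>0 S0 t S > 0"
  shows "rayleigh_potential m \<tau>0 S0 a S < rayleigh_potential m \<tau>0 S0 b S"
proof -
  obtain z where z: "a < z" "z < b" "rayleigh_potential m \<tau>0 S0 b S - rayleigh_potential m \<tau>0 S0 a S
       = (b - a) * rayleigh_gap m \<tau>0 S0 z S"
    using MVT2[OF assms(2) rayleigh_potential_deriv] assms(1) by force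
  have "(b - a) * rayleigh_gap m \<tau>0 S0 z S > 0" using z assms by simp
  then show ?thesis using z by simp
qed

lemma rayleigh_potential_decreasing:
  assumes "0 < a" "a < b" "\<And>t. a < t \<Longrightarrow> t < b \<Longrightarrow> rayleigh_gap m \<tau>0 S0 t S < 0"
  shows "rayleigh_potential m \<tau>0 S0 b S < rayleigh_potential m \<tau>0 S0 a S"
proof -
  obtain z where z: "a < z" "z < b" "rayleigh_potential m \<tau>0 S0 b S - rayleigh_potential m \<tau>0 S0 a S
       = (b - a) * rayleigh_gap m \<tau>0 S0 z S"
    using MVT2[OF assms(2) rayleigh_potential_deriv] assms(1) by force
  have "(b - a) * rayleigh_gap m \<tau>0 S0 z S < 0" using z assms by (simp add: mult_pos_neg)
  then show ?thesis using z by simp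
qed

text \<open>The Rayleigh line is affine and the isentrope strictly convex.\<close>

lemma rayleigh_gap_concave:
  assumes "0 < a" "a < b" "b < c"
  shows "(c - b) * rayleigh_gap m \<tau>0 S0 a S + (b - a) * rayleigh_gap m \<tau>0 S0 c S
       < (c - a) * rayleigh_gap m \<tau>0 S0 b S"
proof -
  have "P a S > P b S - Q b S * (a - b)" "P c S > P b S - Q b S * (c - b)"
    using assms by (intro isentrope_above_tangent; simp)+
  with assms have "(c - b) * (P b S - Q b S * (a - b)) < (c - b) * P a S"
    "(b - a) * (P b S - Q b S * (c - b)) < (b - a) * P c S"
    using assms by simp_all
  then have "(c - a) * P b S < (c - b) * P a S + (b - a) * P c S"
    by (simp add: algebra_simps)
  then show ?thesis by (simp add: rayleigh_gap_def algebra_simps)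
qed

lemma rayleigh_gap_pos_between:
  assumes "0 < a" "a < b" "b < c" "rayleigh_gap m \<tau>0 S0 a S \<ge> 0" "rayleigh_gap m \<tau>0 S0 c S \<ge> 0"
  shows "rayleigh_gap m \<tau>0 S0 b S > 0"
proof -
  have "0 \<le> (c - b) * rayleigh_gap m \<tau>0 S0 a S + (b - a) * rayleigh_gap m \<tau>0 S0 c S"
    using assms by (intro add_nonneg_nonneg mult_nonneg_nonneg) auto
  also note rayleigh_gap_concave[OF assms(1-3)]
  finally show ?thesis using assms by (simp add: zero_less_mult_iff)
qed

text \<open>Both inequalities come from the Rayleigh line tangent to the isentrope at one end state: the isentrope lies above that tangent, so the potential is strictly monotone along it, and changing the entropy to that of the other end state moves the potential further in the same direction.\<close>

lemma speed_sq_between_sound_speeds: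
  assumes "0 < \<tau>" "\<tau> < \<tau>0" "S0 < S" "hugoniot \<tau>0 S0 \<tau> S = 0"
  shows "Q \<tau>0 S0 < speed_sq \<tau>0 S0 \<tau> S" "speed_sq \<tau>0 S0 \<tau> S < Q \<tau> S"
proof -
  have gap: "rayleigh_gap (Q a s) a s t s < 0" if "a > 0" "t > 0" "t \<noteq> a" for a s t
    using isentrope_above_tangent[OF that, of s] by (simp add: rayleigh_gap_def)
  have "0 = rayleigh_potential (Q \<tau>0 S0) \<tau>0 S0 \<tau>0 S0" by (simp add: rayleigh_potential_def)
  also have "\<dots> < rayleigh_potential (Q \<tau>0 S0) \<tau>0 S0 \<tau> S0"
    using assms by (intro rayleigh_potential_decreasing gap) auto
  also have "\<dots> < rayleigh_potential (Q \<tau>0 S0) \<tau>0 S0 \<tau> S"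
    using assms by (simp add: rayleigh_potential_less_iff)
  finally show "Q \<tau>0 S0 < speed_sq \<tau>0 S0 \<tau> S"
    using rayleigh_potential_on_hugoniot[OF assms(4)] assms by (simp add: zero_less_mult_iff)
  have "rayleigh_potential (Q \<tau> S) \<tau> S \<tau>0 S0 < rayleigh_potential (Q \<tau> S) \<tau> S \<tau>0 S"
    using assms by (simp add: rayleigh_potential_less_iff)
  also have "\<dots> < rayleigh_potential (Q \<tau> S) \<tau> S \<tau> S"
    using assms by (intro rayleigh_potential_decreasing gap) auto
  also have "\<dots> = 0" by (simp add: rayleigh_potential_def)
  finally show "speed_sq \<tau>0 S0 \<tau> S < Q \<tau> S"
    using rayleigh_potential_on_hugoniot[of \<tau> S \<tau>0 S0 "Q \<tau> S"] hugoniot_sym[of \<tau> S \<tau>0 S0]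
      speed_sq_sym[of \<tau> S \<tau>0 S0] assms
    by (simp add: mult_less_0_iff)
qed

text \<open>Supersonic motion relative to the state \<open>(\<tau>0, S0)\<close> means that the Rayleigh line is steeper than its isentrope.  If the other state were expanded, both its entropy and its potential would be too small; if it were compressed without gain of entropy, the gap would be positive all the way between the two volumes and the potential would contradict the entropy order.\<close>

lemma lax_imp_compressive:
  assumes pos: "0 < \<tau>" "0 < \<tau>0" "\<tau> \<noteq> \<tau>0" and hug: "hugoniot \<tau>0 S0 \<tau> S = 0"
    and sup: "Q \<tau>0 S0 < speed_sq \<tau>0 S0 \<tau> S"
  shows "\<tau> < \<tau>0" "S0 < S"
proof -
  define m where "m = speed_sq \<tau>0 S0 \<tau> S"
  let ?g = "rayleigh_gap m \<tau>0 S0" and ?G = "rayleigh_potential m \<tau>0 S0"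
  have G0: "?G \<tau>0 S0 = 0" by (simp add: rayleigh_potential_def)
  have G1: "?G \<tau> S = 0" using rayleigh_potential_on_hugoniot[OF hug, of m] pos by (simp add: m_def)
  have g0: "?g \<tau>0 S0 = 0" by (simp add: rayleigh_gap_def)
  have g1: "?g \<tau> S = 0" using rayleigh_gap_speed_sq pos by (simp add: m_def)
  have gS: "?g t s < ?g t s' \<longleftrightarrow> s' < s" if "t > 0" for t s s'
    using P_less_iff[OF that] by (simp add: rayleigh_gap_def)
  show 1: "\<tau> < \<tau>0"
  proof (rule ccontr)
    assume "\<not> \<tau> < \<tau>0"
    then have less: "\<tau>0 < \<tau>" using pos by simp
    \<comment> \<open>the isentrope lies above its tangent at \<open>\<tau>0\<close>, which in turn lies above the steeper Rayleigh line\<close>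
    have neg: "?g t S0 < 0" if "t > \<tau>0" for t
    proof -
      have "Q \<tau>0 S0 * (t - \<tau>0) < m * (t - \<tau>0)" using sup that by (simp add: m_def)
      moreover have "P t S0 > P \<tau>0 S0 - Q \<tau>0 S0 * (t - \<tau>0)"
        using pos that by (intro isentrope_above_tangent) auto
      ultimately show ?thesis unfolding rayleigh_gap_def by linarith
    qed
    have "S < S0" using neg[OF less] g1 gS pos by metis
    then have "?G \<tau> S < ?G \<tau> S0" using pos by (simp add: rayleigh_potential_less_iff)
    also have "\<dots> < ?G \<tau>0 S0" using neg less pos by (intro rayleigh_potential_decreasing) auto
    finally show False using G0 G1 by simp
  qed
  show "S0 < S"
  proof (rule ccontr)
    assume "\<not> S0 < S"
    then have "?g \<tau>0 S \<ge> 0" using g0 gS[OF pos(2), of S0 S] by (cases "S = S0") auto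
    then have "?G \<tau> S < ?G \<tau>0 S"
      using 1 pos g1 by (intro rayleigh_potential_increasing rayleigh_gap_pos_between[of \<tau> _ \<tau>0]) auto
    then show False using G0 G1 \<open>\<not> S0 < S\<close> rayleigh_potential_less_iff[OF pos(2)] by metis
  qed
qed

text \<open>The potential built with the speed of the first shock is nonnegative on the whole isentrope \<open>S1\<close> up to \<open>\<tau>0\<close>, because its only possible minima there are the shock state, where it vanishes, and the end \<open>\<tau>0\<close>, where it equals an energy difference.  Raising the entropy to \<open>S2\<close> makes it positive.\<close>

lemma speed_sq_mono_compressed:
  assumes z1: "0 < \<tau>1" "\<tau>1 < \<tau>0" "S0 < S1" "hugoniot \<tau>0 S0 \<tau>1 S1 = 0"
    and z2: "0 < \<tau>2" "\<tau>2 < \<tau>0" "S1 < S2" "hugoniot \<tau>0 S0 \<tau>2 S2 = 0"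
  shows "speed_sq \<tau>0 S0 \<tau>1 S1 < speed_sq \<tau>0 S0 \<tau>2 S2"
proof -
  define m where "m = speed_sq \<tau>0 S0 \<tau>1 S1"
  let ?g = "\<lambda>t. rayleigh_gap m \<tau>0 S0 t S1" and ?G = "\<lambda>t. rayleigh_potential m \<tau>0 S0 t S1"
  have G1: "?G \<tau>1 = 0" using rayleigh_potential_on_hugoniot[OF z1(4), of m] z1 by (simp add: m_def)
  have g1: "?g \<tau>1 = 0" using rayleigh_gap_speed_sq z1 by (simp add: m_def)
  have g0: "?g \<tau>0 < 0" using P_less_iff[of \<tau>0 S0 S1] z1 by (simp add: rayleigh_gap_def)
  have G0: "?G \<tau>0 > 0" using E_less_iff[of \<tau>0 S0 S1] z1 by (simp add: rayleigh_potential_def)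
  have conc: "(c - b) * ?g a + (b - a) * ?g c < (c - a) * ?g b" if "0 < a" "a < b" "b < c" for a b c
    using rayleigh_gap_concave[OF that] .
  \<comment> \<open>The gap is negative to the left of \<open>\<tau>1\<close>, positive just to its right, and negative again near \<open>\<tau>0\<close>; the last two cases say on which side of the second sign change \<open>\<tau>2\<close> lies.\<close>
  consider "\<tau>2 < \<tau>1" | "\<tau>2 = \<tau>1" | "\<tau>1 < \<tau>2" "?g \<tau>2 \<ge> 0" | "\<tau>1 < \<tau>2" "?g \<tau>2 < 0" by linarith
  then have "0 \<le> ?G \<tau>2"
  proof cases
    case 1
    have tangent: "P t S1 > P \<tau>1 S1 - m * (t - \<tau>1)" if "0 < t" "t < \<tau>1" for t
    proof -
      have "m * (\<tau>1 - t) < Q \<tau>1 S1 * (\<tau>1 - t)"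
        using speed_sq_between_sound_speeds(2)[OF z1] that by (simp add: m_def)
      then show ?thesis using isentrope_above_tangent[of \<tau>1 t S1] z1 that by (simp add: algebra_simps)
    qed
    have "?g t < 0" if "0 < t" "t < \<tau>1" for t
      using tangent[OF that] g1 by (simp add: rayleigh_gap_def algebra_simps)
    then have "?G \<tau>1 < ?G \<tau>2" using 1 z2 by (intro rayleigh_potential_decreasing) auto
    then show ?thesis using G1 by simp
  next
    case 2 then show ?thesis using G1 by simp
  next
    case 3
    then have "?G \<tau>1 < ?G \<tau>2"
      using z1 z2 g1 by (intro rayleigh_potential_increasing rayleigh_gap_pos_between[of \<tau>1 _ \<tau>2]) auto
    then show ?thesis using G1 by simp
  next
    case 4
    have "?g t < 0" if "\<tau>2 < t" "t < \<tau>0" for t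
    proof (rule ccontr)
      assume "\<not> ?g t < 0"
      then have "?g \<tau>2 > 0"
        using 4 that z1 g1 by (intro rayleigh_gap_pos_between[of \<tau>1 _ t]) auto
      then show False using 4 by simp
    qed
    then have "?G \<tau>0 < ?G \<tau>2" using z2 by (intro rayleigh_potential_decreasing) auto
    then show ?thesis using G0 by simp
  qed
  also have "?G \<tau>2 < rayleigh_potential m \<tau>0 S0 \<tau>2 S2"
    using z2 by (simp add: rayleigh_potential_less_iff)
  finally show ?thesis
    using rayleigh_potential_on_hugoniot[OF z2(4)] z2 by (simp add: m_def zero_less_mult_iff)
qed

text \<open>Here the gap changes sign exactly once on the isentrope \<open>S1\<close>, from positive to negative at the shock state, which is therefore the maximum of the potential.\<close>

lemma speed_sq_mono_expanded:
  assumes z1: "0 < \<tau>0" "\<tau>0 < \<tau>1" "S1 < S0" "hugoniot \<tau>0 S0 \<tau>1 S1 = 0"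
    and z2: "\<tau>0 < \<tau>2" "S2 < S1" "hugoniot \<tau>0 S0 \<tau>2 S2 = 0"
  shows "speed_sq \<tau>0 S0 \<tau>2 S2 < speed_sq \<tau>0 S0 \<tau>1 S1"
proof -
  define m where "m = speed_sq \<tau>0 S0 \<tau>1 S1"
  let ?g = "\<lambda>t. rayleigh_gap m \<tau>0 S0 t S1" and ?G = "\<lambda>t. rayleigh_potential m \<tau>0 S0 t S1"
  have G1: "?G \<tau>1 = 0" using rayleigh_potential_on_hugoniot[OF z1(4), of m] z1 by (simp add: m_def)
  have g1: "?g \<tau>1 = 0" using rayleigh_gap_speed_sq z1 by (simp add: m_def)
  have g0: "?g \<tau>0 > 0" using P_less_iff[of \<tau>0 S1 S0] z1 by (simp add: rayleigh_gap_def)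
  have "?G \<tau>2 \<le> 0"
  proof (cases \<tau>2 \<tau>1 rule: linorder_cases)
    case less
    then have "?G \<tau>2 < ?G \<tau>1"
      using z1 z2 g0 g1 by (intro rayleigh_potential_increasing rayleigh_gap_pos_between[of \<tau>0 _ \<tau>1]) auto
    then show ?thesis using G1 by simp
  next
    case equal then show ?thesis using G1 by simp
  next
    case greater
    have "?g t < 0" if "\<tau>1 < t" for t
    proof (rule ccontr)
      assume "\<not> ?g t < 0"
      then have "?g \<tau>1 > 0"
        using that z1 g0 by (intro rayleigh_gap_pos_between[of \<tau>0 _ t]) auto
      then show False using g1 by simp
    qed
    then have "?G \<tau>2 < ?G \<tau>1" using z1 greater by (intro rayleigh_potential_decreasing) auto
    then show ?thesis using G1 by simp
  qed
  moreover have "rayleigh_potential m \<tau>0 S0 \<tau>2 S2 < ?G \<tau>2"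
    using z1 z2 by (simp add: rayleigh_potential_less_iff)
  ultimately have "rayleigh_potential m \<tau>0 S0 \<tau>2 S2 < 0" by simp
  then show ?thesis
    using rayleigh_potential_on_hugoniot[OF z2(3)] z2 by (simp add: m_def mult_less_0_iff)
qed

section \<open>The two branches of the Hugoniot curve\<close>

text \<open>The partial derivative of the Hugoniot function in volume.\<close>

definition hugoniot_deriv :: "real \<Rightarrow> real \<Rightarrow> real \<Rightarrow> real \<Rightarrow> real" where
  "hugoniot_deriv \<tau>0 S0 \<tau> S = (P \<tau>0 S0 - P \<tau> S - Q \<tau> S * (\<tau> - \<tau>0)) / 2"

lemma hugoniot_has_deriv:
  "\<tau> > 0 \<Longrightarrow> ((\<lambda>t. hugoniot \<tau>0 S0 t S) has_real_derivative hugoniot_deriv \<tau>0 S0 \<tau> S) (at \<tau>)"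
  unfolding hugoniot_def
  by (rule derivative_eq_intros E_deriv_volume P_deriv_volume refl | simp add: hugoniot_deriv_def field_simps)+

lemma isCont_hugoniot_in_volume: "\<tau> > 0 \<Longrightarrow> isCont (\<lambda>t. hugoniot \<tau>0 S0 t S) \<tau>"
  by (rule DERIV_isCont[OF hugoniot_has_deriv])

lemma isCont_hugoniot_in_entropy: "\<tau> > 0 \<Longrightarrow> isCont (\<lambda>S. hugoniot \<tau>0 S0 \<tau> S) S"
  unfolding hugoniot_def
  by (intro continuous_intros DERIV_isCont[OF E_deriv_entropy] DERIV_isCont[OF P_deriv_entropy]) auto

text \<open>Twice this derivative is the height of \<open>P \<tau>0 S0\<close> above the point at \<open>\<tau>0\<close> of the tangent to the isentrope at \<open>\<tau>\<close>; by convexity that point sinks as the point of tangency moves away from \<open>\<tau>0\<close>.\<close>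

lemma hugoniot_deriv_antimono_compressed:
  assumes "0 < t" "t < \<tau>" "\<tau> \<le> \<tau>0"
  shows "hugoniot_deriv \<tau>0 S0 \<tau> S < hugoniot_deriv \<tau>0 S0 t S"
proof -
  have "P \<tau> S > P t S - Q t S * (\<tau> - t)" using assms by (intro isentrope_above_tangent) auto
  moreover have "Q \<tau> S * (\<tau>0 - \<tau>) \<le> Q t S * (\<tau>0 - \<tau>)"
    using Q_antimono[of t \<tau> S] assms by (intro mult_right_mono) auto
  ultimately have "P \<tau>0 S0 - P \<tau> S - Q \<tau> S * (\<tau> - \<tau>0) < P \<tau>0 S0 - P t S - Q t S * (t - \<tau>0)"
    by (simp add: algebra_simps)
  then show ?thesis by (simp add: hugoniot_deriv_def)
qed

lemma hugoniot_deriv_mono_expanded: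
  assumes "0 < \<tau>0" "\<tau>0 \<le> \<tau>" "\<tau> < t"
  shows "hugoniot_deriv \<tau>0 S0 \<tau> S < hugoniot_deriv \<tau>0 S0 t S"
proof -
  have "P \<tau> S > P t S - Q t S * (\<tau> - t)" using assms by (intro isentrope_above_tangent) auto
  moreover have "Q t S * (\<tau> - \<tau>0) \<le> Q \<tau> S * (\<tau> - \<tau>0)"
    using Q_antimono[of \<tau> t S] assms by (intro mult_right_mono) auto
  ultimately have "P \<tau>0 S0 - P \<tau> S - Q \<tau> S * (\<tau> - \<tau>0) < P \<tau>0 S0 - P t S - Q t S * (t - \<tau>0)"
    by (simp add: algebra_simps)
  then show ?thesis by (simp add: hugoniot_deriv_def)
qed

text \<open>The weak inequality on the derivative makes this apply at a shock state as well as at \<open>(\<tau>0, S0)\<close> itself, where the derivative vanishes.\<close>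

lemma hugoniot_neg_below:
  assumes "0 < t" "t < \<tau>" "\<tau> \<le> \<tau>0" "hugoniot \<tau>0 S0 \<tau> S = 0" "hugoniot_deriv \<tau>0 S0 \<tau> S \<ge> 0"
  shows "hugoniot \<tau>0 S0 t S < 0"
proof -
  obtain z where z: "t < z" "z < \<tau>"
    "hugoniot \<tau>0 S0 \<tau> S - hugoniot \<tau>0 S0 t S = (\<tau> - t) * hugoniot_deriv \<tau>0 S0 z S"
    using MVT2[OF assms(2) hugoniot_has_deriv] assms(1) by force
  have "hugoniot_deriv \<tau>0 S0 z S > 0"
    using hugoniot_deriv_antimono_compressed[of z \<tau> \<tau>0 S0 S] z assms by simp
  then have "(\<tau> - t) * hugoniot_deriv \<tau>0 S0 z S > 0" using assms by simp
  then show ?thesis using z assms by simp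
qed

lemma hugoniot_pos_above:
  assumes "0 < \<tau>0" "\<tau>0 \<le> \<tau>" "\<tau> < t" "hugoniot \<tau>0 S0 \<tau> S = 0" "hugoniot_deriv \<tau>0 S0 \<tau> S \<ge> 0"
  shows "hugoniot \<tau>0 S0 t S > 0"
proof -
  obtain z where z: "\<tau> < z" "z < t"
    "hugoniot \<tau>0 S0 t S - hugoniot \<tau>0 S0 \<tau> S = (t - \<tau>) * hugoniot_deriv \<tau>0 S0 z S"
    using MVT2[OF assms(3) hugoniot_has_deriv] assms(1,2) by force
  have "hugoniot_deriv \<tau>0 S0 z S > 0"
    using hugoniot_deriv_mono_expanded[of \<tau>0 \<tau> z S0 S] z assms by simp
  then have "(t - \<tau>) * hugoniot_deriv \<tau>0 S0 z S > 0" using assms by simp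
  then show ?thesis using z assms by simp
qed

lemma hugoniot_deriv_eq:
  assumes "\<tau> \<noteq> \<tau>0"
  shows "hugoniot_deriv \<tau>0 S0 \<tau> S = (speed_sq \<tau>0 S0 \<tau> S - Q \<tau> S) * (\<tau> - \<tau>0) / 2"
proof -
  have "speed_sq \<tau>0 S0 \<tau> S * (\<tau> - \<tau>0) = P \<tau>0 S0 - P \<tau> S" using assms by (simp add: speed_sq_def)
  then show ?thesis by (simp add: hugoniot_deriv_def left_diff_distrib)
qed

text \<open>The subsonic Lax inequality behind the shock, respectively the supersonic one ahead of it, is transversality of the Hugoniot curve to the lines of constant entropy.  This is why entropy is a good parameter.\<close>

lemma hugoniot_deriv_pos:
  assumes "0 < \<tau>" "0 < \<tau>0" "hugoniot \<tau>0 S0 \<tau> S = 0" "\<tau> < \<tau>0 \<and> S0 < S \<or> \<tau>0 < \<tau> \<and> S < S0"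
  shows "hugoniot_deriv \<tau>0 S0 \<tau> S > 0"
  using assms(4)
proof
  assume "\<tau> < \<tau>0 \<and> S0 < S"
  with speed_sq_between_sound_speeds(2)[of \<tau> \<tau>0 S0 S] assms show ?thesis
    by (simp add: hugoniot_deriv_eq mult_neg_neg)
next
  assume "\<tau>0 < \<tau> \<and> S < S0"
  with speed_sq_between_sound_speeds(1)[of \<tau>0 \<tau> S S0] assms speed_sq_sym[of \<tau> S \<tau>0 S0] hugoniot_sym[of \<tau> S \<tau>0 S0]
  show ?thesis by (simp add: hugoniot_deriv_eq)
qed

end

text \<open>The limits in volume make the 1-Hugoniot curves global; joint convexity of the energy makes the entropy concave.\<close>

locale gas = equation_of_state +
  assumes at_volume_ends: "volume_limits E"
    and energy_convex: "convex_on ({0<..} \<times> UNIV) (\<lambda>(\<tau>, S). E \<tau> S)"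
begin

text \<open>If the pressure stays bounded on the isentrope as \<open>\<tau>\<close> tends to \<open>0\<close>, the limit of \<open>e_check\<close> forces the energy to \<open>0\<close>.  Otherwise the work term beats the energy, which grows at most like pressure times a small volume.\<close>

lemma ex_hugoniot_neg:
  assumes "0 < \<tau>0"
  shows "\<exists>t>0. t < \<tau>0 \<and> hugoniot \<tau>0 S0 t S < 0"
proof (cases "\<exists>B. \<forall>t. 0 < t \<longrightarrow> t < \<tau>0 \<longrightarrow> P t S \<le> B")
  case True
  then obtain B where B: "\<And>t. 0 < t \<Longrightarrow> t < \<tau>0 \<Longrightarrow> P t S \<le> B" by blast
  have "B > 0" using B[of "\<tau>0 / 2"] signs(2)[of "\<tau>0 / 2" S] assms by simp
  then have "((\<lambda>t. e_check E t B) \<longlongrightarrow> 0) (at_right 0)"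
    using at_volume_ends by (simp add: volume_limits_def)
  then have "\<forall>\<^sub>F t in at_right 0. e_check E t B < E \<tau>0 S0"
    using signs(1)[OF assms] by (rule order_tendstoD)
  moreover have "\<forall>\<^sub>F t in at_right 0. t \<in> {0<..<\<tau>0}" using assms by (rule eventually_at_right_real)
  ultimately have "\<forall>\<^sub>F t in at_right 0. e_check E t B < E \<tau>0 S0 \<and> t \<in> {0<..<\<tau>0}"
    by (rule eventually_conj)
  then obtain t where t: "e_check E t B < E \<tau>0 S0" "0 < t" "t < \<tau>0"
    using eventually_happens'[OF trivial_limit_at_right_real] by fastforce
  have "P t S \<le> P t (S_check E t B)" using P_S_check[of t B] B[of t] t \<open>B > 0\<close> by simp
  then have "S \<le> S_check E t B" using P_less_iff[OF t(2)] by (meson not_le)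
  then have "E t S \<le> e_check E t B" unfolding e_check_def using E_less_iff[OF t(2)] by (meson not_le)
  moreover have "(P t S + P \<tau>0 S0) / 2 * (t - \<tau>0) < 0"
    using signs(2)[of t S] signs(2)[of \<tau>0 S0] t by (intro mult_pos_neg) auto
  ultimately show ?thesis using t by (intro exI[of _ t]) (simp add: hugoniot_def)
next
  case False
  \<comment> \<open>Any reference volume below \<open>\<tau>0 / 2\<close> would do: the energy gained by compressing further from it is less than the work term \<open>p \<tau>0 / 2\<close>.\<close>
  let ?t1 = "\<tau>0 / 4"
  define B where "B = max (P ?t1 S) (4 * E ?t1 S / \<tau>0)"
  obtain t where t: "0 < t" "t < \<tau>0" "P t S > B" using False by (meson not_le)
  have "t < ?t1"
  proof (rule ccontr)
    assume "\<not> t < ?t1"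
    then have "P t S \<le> P ?t1 S" using P_antimono[of ?t1 t S] assms by (cases "t = ?t1") auto
    then show False using t by (simp add: B_def)
  qed
  obtain z where z: "t < z" "z < ?t1" "E ?t1 S - E t S = (?t1 - t) * (- P z S)"
    using MVT2[OF \<open>t < ?t1\<close> E_deriv_volume] t by force
  have "(?t1 - t) * P z S \<le> (?t1 - t) * P t S"
    using P_antimono[of t z S] z t by (intro mult_left_mono) auto
  moreover have "E t S = E ?t1 S + (?t1 - t) * P z S" using z(3) by (simp add: algebra_simps)
  ultimately have "E t S \<le> E ?t1 S + (?t1 - t) * P t S" by linarith
  moreover have "E ?t1 S < P t S * \<tau>0 / 4"
    using t(3) assms by (simp add: B_def field_simps)
  moreover have "P \<tau>0 S0 * (\<tau>0 - t) > 0" "P t S * t > 0" "E \<tau>0 S0 > 0"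
    using signs t assms by simp_all
  ultimately have "hugoniot \<tau>0 S0 t S < 0"
    by (simp add: hugoniot_def field_simps)
  then show ?thesis using t by blast
qed

text \<open>Along an isentrope above \<open>S0\<close> the Hugoniot function is positive at \<open>\<tau>0\<close> and negative at some smaller volume, and it increases through each of its zeros; so it has exactly one, with known signs on both sides.\<close>

lemma compressed_branch:
  assumes "0 < \<tau>0" "S0 < S"
  obtains \<tau> where "0 < \<tau>" "\<tau> < \<tau>0" "hugoniot \<tau>0 S0 \<tau> S = 0"
    "\<And>t. 0 < t \<Longrightarrow> t < \<tau> \<Longrightarrow> hugoniot \<tau>0 S0 t S < 0"
    "\<And>t. \<tau> < t \<Longrightarrow> t < \<tau>0 \<Longrightarrow> hugoniot \<tau>0 S0 t S > 0"
proof -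
  let ?H = "\<lambda>t. hugoniot \<tau>0 S0 t S"
  have top: "?H \<tau>0 > 0" using assms E_less_iff[of \<tau>0 S0 S] by (simp add: hugoniot_def)
  have zero: "\<exists>z. t \<le> z \<and> z < \<tau>0 \<and> ?H z = 0" if "0 < t" "t < \<tau>0" "?H t \<le> 0" for t
  proof -
    have "\<exists>z. t \<le> z \<and> z \<le> \<tau>0 \<and> ?H z = 0"
      using that top by (intro IVT allI impI isCont_hugoniot_in_volume) auto
    then obtain z where z: "t \<le> z" "z \<le> \<tau>0" "?H z = 0" by blast
    moreover have "z \<noteq> \<tau>0" using z top by auto
    ultimately show ?thesis by (intro exI[of _ z]) simp
  qed
  obtain a where "0 < a" "a < \<tau>0" "?H a < 0" using ex_hugoniot_neg[OF assms(1)] by blast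
  then obtain \<tau> where \<tau>: "0 < \<tau>" "\<tau> < \<tau>0" "?H \<tau> = 0"
    using zero[of a] by (meson less_imp_le less_le_trans)
  have below: "?H t < 0" if "0 < t" "t < z" "z < \<tau>0" "?H z = 0" for t z
    using that hugoniot_deriv_pos[of z \<tau>0 S0 S] assms by (intro hugoniot_neg_below[of t z]) auto
  show ?thesis
  proof (rule that[OF \<tau> below])
    fix t assume t: "\<tau> < t" "t < \<tau>0"
    show "?H t > 0"
    proof (rule ccontr)
      assume "\<not> ?H t > 0"
      then obtain z where "t \<le> z" "z < \<tau>0" "?H z = 0" using zero[of t] t \<tau> by (meson less_trans not_less)
      then show False using below[of \<tau> z] t \<tau> by simp
    qed
  qed (use \<tau> in auto)
qed

text \<open>The mirror image of the compressed case; the work against the pressure of the given state makes the Hugoniot function positive at large volume.\<close>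

lemma expanded_branch:
  assumes "0 < \<tau>0" "S < S0"
  obtains \<tau> where "\<tau>0 < \<tau>" "hugoniot \<tau>0 S0 \<tau> S = 0"
    "\<And>t. \<tau>0 < t \<Longrightarrow> t < \<tau> \<Longrightarrow> hugoniot \<tau>0 S0 t S < 0"
    "\<And>t. \<tau> < t \<Longrightarrow> hugoniot \<tau>0 S0 t S > 0"
proof -
  let ?H = "\<lambda>t. hugoniot \<tau>0 S0 t S"
  have bot: "?H \<tau>0 < 0" using assms E_less_iff[of \<tau>0 S S0] by (simp add: hugoniot_def)
  have zero: "\<exists>z. \<tau>0 < z \<and> z \<le> t \<and> ?H z = 0" if "\<tau>0 < t" "?H t \<ge> 0" for t
  proof -
    have "\<exists>z. \<tau>0 \<le> z \<and> z \<le> t \<and> ?H z = 0"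
      using that bot assms by (intro IVT allI impI isCont_hugoniot_in_volume) auto
    then obtain z where z: "\<tau>0 \<le> z" "z \<le> t" "?H z = 0" by blast
    moreover have "z \<noteq> \<tau>0" using z bot by auto
    ultimately show ?thesis by (intro exI[of _ z]) simp
  qed
  \<comment> \<open>at this volume the work against the pressure \<open>P \<tau>0 S0\<close> alone already equals the initial energy\<close>
  define b where "b = \<tau>0 + 2 * E \<tau>0 S0 / P \<tau>0 S0"
  have b: "\<tau>0 < b" using signs[OF assms(1)] by (simp add: b_def)
  have "E \<tau>0 S0 = P \<tau>0 S0 / 2 * (b - \<tau>0)" using signs(2)[OF assms(1), of S0] by (simp add: b_def)
  also have "\<dots> \<le> (P b S + P \<tau>0 S0) / 2 * (b - \<tau>0)"
    using b signs(2)[of b S] assms by (intro mult_right_mono) auto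
  finally have "?H b \<ge> 0" using signs(1)[of b S] b assms by (simp add: hugoniot_def)
  then obtain \<tau> where \<tau>: "\<tau>0 < \<tau>" "?H \<tau> = 0" using zero[of b] b by fastforce
  have above: "?H t > 0" if "\<tau>0 < z" "z < t" "?H z = 0" for t z
    using that hugoniot_deriv_pos[of z \<tau>0 S0 S] assms by (intro hugoniot_pos_above[of \<tau>0 z]) auto
  show ?thesis
  proof (rule that[OF \<tau>])
    fix t assume t: "\<tau>0 < t" "t < \<tau>"
    show "?H t < 0"
    proof (rule ccontr)
      assume "\<not> ?H t < 0"
      then obtain z where "\<tau>0 < z" "z \<le> t" "?H z = 0" using zero[of t] t by fastforce
      then show False using above[of z \<tau>] t \<tau> by simp
    qed
  qed (use \<tau> above in auto)
qed

text \<open>Both branches are glued at \<open>S0\<close> with the value \<open>\<tau>0\<close>, so that the continuity of the result also expresses that the curves emanate from the given state.\<close>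

definition hugoniot_volume :: "real \<Rightarrow> real \<Rightarrow> real \<Rightarrow> real" where
  "hugoniot_volume \<tau>0 S0 S = (if S = S0 then \<tau>0 else
     THE \<tau>. 0 < \<tau> \<and> hugoniot \<tau>0 S0 \<tau> S = 0 \<and> (S0 < S \<and> \<tau> < \<tau>0 \<or> S < S0 \<and> \<tau>0 < \<tau>))"

lemma hugoniot_volume_compressed:
  assumes "0 < \<tau>0" "S0 < S"
  shows "0 < hugoniot_volume \<tau>0 S0 S" "hugoniot_volume \<tau>0 S0 S < \<tau>0"
    "hugoniot \<tau>0 S0 (hugoniot_volume \<tau>0 S0 S) S = 0"
    "\<And>t. 0 < t \<Longrightarrow> t < hugoniot_volume \<tau>0 S0 S \<Longrightarrow> hugoniot \<tau>0 S0 t S < 0"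
    "\<And>t. hugoniot_volume \<tau>0 S0 S < t \<Longrightarrow> t < \<tau>0 \<Longrightarrow> hugoniot \<tau>0 S0 t S > 0"
proof -
  obtain \<tau> where \<tau>: "0 < \<tau>" "\<tau> < \<tau>0" "hugoniot \<tau>0 S0 \<tau> S = 0"
    and below: "\<And>t. 0 < t \<Longrightarrow> t < \<tau> \<Longrightarrow> hugoniot \<tau>0 S0 t S < 0"
    and above: "\<And>t. \<tau> < t \<Longrightarrow> t < \<tau>0 \<Longrightarrow> hugoniot \<tau>0 S0 t S > 0"
    by (rule compressed_branch[OF assms]) blast
  have "(THE \<tau>. 0 < \<tau> \<and> hugoniot \<tau>0 S0 \<tau> S = 0 \<and> (S0 < S \<and> \<tau> < \<tau>0 \<or> S < S0 \<and> \<tau>0 < \<tau>)) = \<tau>"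
  proof (rule the_equality)
    fix t assume "0 < t \<and> hugoniot \<tau>0 S0 t S = 0 \<and> (S0 < S \<and> t < \<tau>0 \<or> S < S0 \<and> \<tau>0 < t)"
    then show "t = \<tau>" using below[of t] above[of t] assms by (cases t \<tau> rule: linorder_cases) simp_all
  qed (use assms \<tau> in simp)
  then have eq: "hugoniot_volume \<tau>0 S0 S = \<tau>"
    unfolding hugoniot_volume_def using assms by simp
  show "0 < hugoniot_volume \<tau>0 S0 S" "hugoniot_volume \<tau>0 S0 S < \<tau>0"
    "hugoniot \<tau>0 S0 (hugoniot_volume \<tau>0 S0 S) S = 0"
    "\<And>t. 0 < t \<Longrightarrow> t < hugoniot_volume \<tau>0 S0 S \<Longrightarrow> hugoniot \<tau>0 S0 t S < 0"
    "\<And>t. hugoniot_volume \<tau>0 S0 S < t \<Longrightarrow> t < \<tau>0 \<Longrightarrow> hugoniot \<tau>0 S0 t S > 0"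
    unfolding eq using \<tau> below above by blast+
qed

lemma hugoniot_volume_expanded:
  assumes "0 < \<tau>0" "S < S0"
  shows "\<tau>0 < hugoniot_volume \<tau>0 S0 S"
    "hugoniot \<tau>0 S0 (hugoniot_volume \<tau>0 S0 S) S = 0"
    "\<And>t. \<tau>0 < t \<Longrightarrow> t < hugoniot_volume \<tau>0 S0 S \<Longrightarrow> hugoniot \<tau>0 S0 t S < 0"
    "\<And>t. hugoniot_volume \<tau>0 S0 S < t \<Longrightarrow> hugoniot \<tau>0 S0 t S > 0"
proof -
  obtain \<tau> where \<tau>: "\<tau>0 < \<tau>" "hugoniot \<tau>0 S0 \<tau> S = 0"
    and below: "\<And>t. \<tau>0 < t \<Longrightarrow> t < \<tau> \<Longrightarrow> hugoniot \<tau>0 S0 t S < 0"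
    and above: "\<And>t. \<tau> < t \<Longrightarrow> hugoniot \<tau>0 S0 t S > 0"
    by (rule expanded_branch[OF assms]) blast
  have "(THE \<tau>. 0 < \<tau> \<and> hugoniot \<tau>0 S0 \<tau> S = 0 \<and> (S0 < S \<and> \<tau> < \<tau>0 \<or> S < S0 \<and> \<tau>0 < \<tau>)) = \<tau>"
  proof (rule the_equality)
    fix t assume "0 < t \<and> hugoniot \<tau>0 S0 t S = 0 \<and> (S0 < S \<and> t < \<tau>0 \<or> S < S0 \<and> \<tau>0 < t)"
    then show "t = \<tau>" using below[of t] above[of t] assms by (cases t \<tau> rule: linorder_cases) simp_all
  qed (use assms \<tau> in simp)
  then have eq: "hugoniot_volume \<tau>0 S0 S = \<tau>"
    unfolding hugoniot_volume_def using assms by simp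
  show "\<tau>0 < hugoniot_volume \<tau>0 S0 S"
    "hugoniot \<tau>0 S0 (hugoniot_volume \<tau>0 S0 S) S = 0"
    "\<And>t. \<tau>0 < t \<Longrightarrow> t < hugoniot_volume \<tau>0 S0 S \<Longrightarrow> hugoniot \<tau>0 S0 t S < 0"
    "\<And>t. hugoniot_volume \<tau>0 S0 S < t \<Longrightarrow> hugoniot \<tau>0 S0 t S > 0"
    unfolding eq using \<tau> below above by blast+
qed

lemma hugoniot_volume_unique:
  assumes "0 < \<tau>0" "0 < \<tau>" "hugoniot \<tau>0 S0 \<tau> S = 0" "S0 < S \<and> \<tau> < \<tau>0 \<or> S < S0 \<and> \<tau>0 < \<tau>"
  shows "hugoniot_volume \<tau>0 S0 S = \<tau>"
  using assms(4)
proof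
  assume "S0 < S \<and> \<tau> < \<tau>0"
  with hugoniot_volume_compressed(4,5)[OF assms(1), of S0 S \<tau>] assms show ?thesis
    by (cases \<tau> "hugoniot_volume \<tau>0 S0 S" rule: linorder_cases) auto
next
  assume "S < S0 \<and> \<tau>0 < \<tau>"
  with hugoniot_volume_expanded(3,4)[OF assms(1), of S S0 \<tau>] assms show ?thesis
    by (cases \<tau> "hugoniot_volume \<tau>0 S0 S" rule: linorder_cases) auto
qed

lemma hugoniot_volume_self [simp]: "hugoniot_volume \<tau>0 S0 S0 = \<tau>0"
  by (simp add: hugoniot_volume_def)

lemma hugoniot_volume_pos: "0 < \<tau>0 \<Longrightarrow> 0 < hugoniot_volume \<tau>0 S0 S"
  using hugoniot_volume_compressed(1)[of \<tau>0 S0 S] hugoniot_volume_expanded(1)[of \<tau>0 S S0]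
  by (cases S S0 rule: linorder_cases) auto

text \<open>A substitute for the implicit function theorem that also covers \<open>S = S0\<close>, where the \<open>\<tau>\<close>-derivative degenerates.  At a volume slightly off the zero the Hugoniot function has a strict sign, which persists for nearby entropies and keeps their zeros on the same side.\<close>

lemma isCont_hugoniot_volume:
  assumes \<tau>0: "0 < \<tau>0"
  shows "isCont (hugoniot_volume \<tau>0 S0) S"
proof -
  let ?f = "hugoniot_volume \<tau>0 S0" and ?H = "hugoniot \<tau>0 S0"
  have H0: "?H \<tau>0 S0 = 0" "hugoniot_deriv \<tau>0 S0 \<tau>0 S0 = 0"
    by (simp_all add: hugoniot_def hugoniot_deriv_def)
  note comp = hugoniot_volume_compressed[OF \<tau>0] and expn = hugoniot_volume_expanded[OF \<tau>0]
  have ev: "\<forall>\<^sub>F S' in at S. ?H t S' < 0" if "t > 0" "?H t S < 0" for t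
    using isCont_hugoniot_in_entropy[OF that(1)] that(2) unfolding isCont_def by (rule order_tendstoD)
  have ev': "\<forall>\<^sub>F S' in at S. ?H t S' > 0" if "t > 0" "?H t S > 0" for t
    using isCont_hugoniot_in_entropy[OF that(1)] that(2) unfolding isCont_def by (rule order_tendstoD)
  have near: "\<forall>\<^sub>F S' in at S. S' > S0" if "S > S0" using that tendsto_ident_at by (rule order_tendstoD(1)[rotated])
  have near': "\<forall>\<^sub>F S' in at S. S' < S0" if "S < S0" using that tendsto_ident_at by (rule order_tendstoD(2)[rotated])
  \<comment> \<open>The barrier \<open>t\<close> must lie on the side of \<open>\<tau>0\<close> on which the sign of the Hugoniot function is known, which makes the distinction by branch necessary.\<close>
  have lower: "\<forall>\<^sub>F S' in at S. a < ?f S'" if a: "a < ?f S" for a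
  proof (cases "S < S0")
    case True
    then have "max a \<tau>0 < ?f S" using expn(1) a by simp
    then obtain t where t: "max a \<tau>0 < t" "t < ?f S" using dense by blast
    have "?H t S < 0" using t True by (intro expn(3)) auto
    then have "\<forall>\<^sub>F S' in at S. ?H t S' < 0" using t \<tau>0 by (intro ev) auto
    with near'[OF True] show ?thesis
    proof eventually_elim
      case (elim S')
      then have "\<not> ?f S' < t" using expn(4)[of S' S0 t] by auto
      then show ?case using t by simp
    qed
  next
    case False
    then have "max a 0 < ?f S" using hugoniot_volume_pos[OF \<tau>0] a by simp
    then obtain t where t: "max a 0 < t" "t < ?f S" using dense by blast
    have t0: "t < \<tau>0" using t False comp(2)[of S0 S] by (cases "S = S0") auto
    have "?H t S < 0"
    proof (cases "S = S0")
      case True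
      then show ?thesis using t t0 H0 hugoniot_neg_below[of t \<tau>0 \<tau>0 S0 S0] by simp
    next
      case F: False
      then show ?thesis using comp(4) t False by simp
    qed
    then have "\<forall>\<^sub>F S' in at S. ?H t S' < 0" using t by (intro ev) auto
    then show ?thesis
    proof eventually_elim
      case (elim S')
      show ?case
      proof (cases S' S0 rule: linorder_cases)
        case less then show ?thesis using expn(1)[OF less] t t0 by simp
      next
        case equal then show ?thesis using t t0 by simp
      next
        case greater
        then have "\<not> ?f S' < t" using comp(5)[OF greater, of t] t0 elim by auto
        then show ?thesis using t by simp
      qed
    qed
  qed
  have upper: "\<forall>\<^sub>F S' in at S. ?f S' < a" if a: "?f S < a" for a
  proof (cases "S > S0")
    case True
    then have "?f S < min a \<tau>0" using comp(2) a by simp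
    then obtain t where t: "?f S < t" "t < min a \<tau>0" using dense by blast
    have "?H t S > 0" using t True by (intro comp(5)) auto
    then have "\<forall>\<^sub>F S' in at S. ?H t S' > 0" using t hugoniot_volume_pos[OF \<tau>0, of S0 S] by (intro ev') auto
    with near[OF True] show ?thesis
    proof eventually_elim
      case (elim S')
      then have "\<not> t < ?f S'" using comp(4)[of S0 S' t] t hugoniot_volume_pos[OF \<tau>0, of S0 S] by auto
      then show ?case using t by simp
    qed
  next
    case False
    obtain t where t: "?f S < t" "t < a" using a dense by blast
    have t0: "\<tau>0 < t" using t False expn(1)[of S S0] by (cases "S = S0") auto
    have "?H t S > 0"
    proof (cases "S = S0")
      case True
      then show ?thesis using t t0 H0 \<tau>0 hugoniot_pos_above[of \<tau>0 \<tau>0 t S0 S0] by simp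
    next
      case F: False
      then show ?thesis using expn(4) t False by simp
    qed
    then have "\<forall>\<^sub>F S' in at S. ?H t S' > 0" using t0 \<tau>0 by (intro ev') auto
    then show ?thesis
    proof eventually_elim
      case (elim S')
      show ?case
      proof (cases S' S0 rule: linorder_cases)
        case greater then show ?thesis using comp(2)[OF greater] t t0 by simp
      next
        case equal then show ?thesis using t t0 by simp
      next
        case less
        then have "\<not> t < ?f S'" using expn(3)[OF less, of t] t0 elim by auto
        then show ?thesis using t by simp
      qed
    qed
  qed
  show ?thesis unfolding isCont_def by (rule order_tendstoI[OF lower upper])
qed

section \<open>Entropy as a function of volume and energy\<close>

lemma ex1_entropy: assumes "\<tau> > 0" "e > 0" shows "\<exists>!S. E \<tau> S = e"
proof (rule ex_ex1I)
  have lim: "((\<lambda>S. E \<tau> S) \<longlongrightarrow> 0) at_bot" "filterlim (\<lambda>S. E \<tau> S) at_top at_top"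
    using at_entropy_ends assms(1) by (auto simp: entropy_limits_def)
  obtain a where a: "E \<tau> a < e"
    using order_tendstoD(2)[OF lim(1) assms(2)] eventually_happens' trivial_limit_at_bot_linorder by blast
  obtain b where b: "E \<tau> b > e"
    using filterlim_at_top_dense[THEN iffD1, OF lim(2)] eventually_happens' trivial_limit_at_top_linorder by blast
  have "a < b" using a b E_less_iff[OF assms(1)] by (smt (verit))
  then show "\<exists>S. E \<tau> S = e"
    using IVT[of "E \<tau>" a e b] a b DERIV_isCont[OF E_deriv_entropy[OF assms(1)]] by force
  show "\<And>S S'. E \<tau> S = e \<Longrightarrow> E \<tau> S' = e \<Longrightarrow> S = S'"
    using E_less_iff[OF assms(1)] by (metis linorder_neqE less_irrefl)
qed

lemma E_S_hat: "\<tau> > 0 \<Longrightarrow> e > 0 \<Longrightarrow> E \<tau> (S_hat E \<tau> e) = e"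
  unfolding S_hat_def using ex1_entropy by (rule theI')

lemma S_hat_E [simp]: "\<tau> > 0 \<Longrightarrow> S_hat E \<tau> (E \<tau> S) = S"
  unfolding S_hat_def using ex1_entropy[of \<tau> "E \<tau> S"] signs(1) by (intro the1_equality) auto

text \<open>The inverse function theorem for \<open>(\<tau>, S) \<mapsto> (\<tau>, E \<tau> S)\<close>, a bijection onto \<open>\<tau> > 0\<close>, \<open>e > 0\<close>.\<close>

lemma S_hat_has_derivative:
  assumes "\<tau> > 0" "e > 0"
  defines "S \<equiv> S_hat E \<tau> e"
  shows "((\<lambda>z. S_hat E (fst z) (snd z)) has_derivative
     (\<lambda>h. (P \<tau> S * fst h + snd h) / T \<tau> S)) (at (\<tau>, e))"
proof -
  let ?f = "\<lambda>z. (fst z, E (fst z) (snd z))" and ?g = "\<lambda>z. (fst z, S_hat E (fst z) (snd z))"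
  let ?f' = "\<lambda>h. (fst h, - P \<tau> S * fst h + T \<tau> S * snd h)"
  let ?g' = "\<lambda>h. (fst h, (P \<tau> S * fst h + snd h) / T \<tau> S)"
  have f': "(?f has_derivative ?f') (at (\<tau>, S))"
    by (intro has_derivative_Pair has_derivative_fst has_derivative_ident E_has_derivative assms)
  have cont: "continuous_on ({0<..} \<times> UNIV) ?f"
  proof (intro continuous_at_imp_continuous_on ballI)
    fix z :: "real \<times> real" assume "z \<in> {0<..} \<times> UNIV"
    then have "isCont (\<lambda>z. E (fst z) (snd z)) z"
      using has_derivative_continuous[OF E_has_derivative[of "fst z" "snd z"]] by (cases z) simp
    then show "isCont ?f z" by (intro continuous_intros)
  qed
  have "(?g has_derivative ?g') (at (?f (\<tau>, S)))"
  proof (rule has_derivative_inverse_strong[where f = ?f and S = "{0<..} \<times> UNIV"])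
    show "?f' \<circ> ?g' = id" using signs(3)[OF assms(1), of S] by (auto simp: fun_eq_iff)
    show "(?f has_derivative ?f') (at (\<tau>, S))" by (rule f')
  qed (use assms cont open_domain in auto)
  moreover have "?f (\<tau>, S) = (\<tau>, e)" using E_S_hat assms by simp
  ultimately have "(?g has_derivative ?g') (at (\<tau>, e))" by simp
  from has_derivative_snd[OF this] show ?thesis by simp
qed

text \<open>Every thermodynamic quantity is a smooth function of \<open>(\<tau>, S)\<close> composed with the entropy; one chain rule serves them all.\<close>

lemma thermodynamic_has_derivative:
  assumes f: "smooth_eos f" and pos: "\<tau> > 0" "e > 0"
  defines "S \<equiv> S_hat E \<tau> e"
  shows "((\<lambda>z. f (fst z) (S_hat E (fst z) (snd z))) has_derivative
     (\<lambda>h. (pd1 f \<tau> S + pd2 f \<tau> S * P \<tau> S / T \<tau> S) * fst h + pd2 f \<tau> S / T \<tau> S * snd h)) (at (\<tau>, e))"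
proof -
  have "((\<lambda>z. (fst z, S_hat E (fst z) (snd z))) has_derivative
      (\<lambda>h. (fst h, (P \<tau> S * fst h + snd h) / T \<tau> S))) (at (\<tau>, e))"
    unfolding S_def by (intro has_derivative_Pair has_derivative_fst has_derivative_ident S_hat_has_derivative pos)
  moreover have "((\<lambda>z. f (fst z) (snd z)) has_derivative (\<lambda>h. pd1 f \<tau> S * fst h + pd2 f \<tau> S * snd h))
      (at (fst (\<tau>, e), S_hat E (fst (\<tau>, e)) (snd (\<tau>, e))))"
    using smooth_eos_has_derivative[OF f pos(1)] by (simp add: S_def)
  ultimately have "((\<lambda>z. f (fst z) (S_hat E (fst z) (snd z))) has_derivative
      (\<lambda>h. pd1 f \<tau> S * fst h + pd2 f \<tau> S * ((P \<tau> S * fst h + snd h) / T \<tau> S))) (at (\<tau>, e))"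
    using has_derivative_compose[where f = "\<lambda>z. (fst z, S_hat E (fst z) (snd z))"
      and g = "\<lambda>z. f (fst z) (snd z)"] by force
  moreover have "(\<lambda>h. pd1 f \<tau> S * fst h + pd2 f \<tau> S * ((P \<tau> S * fst h + snd h) / T \<tau> S)) =
     (\<lambda>h. (pd1 f \<tau> S + pd2 f \<tau> S * P \<tau> S / T \<tau> S) * fst h + pd2 f \<tau> S / T \<tau> S * snd h)"
    by (rule ext) (simp add: algebra_simps add_divide_distrib)
  ultimately show ?thesis by (simp only:)
qed

lemma pd_thermodynamic:
  assumes f: "smooth_eos f" and pos: "\<tau> > 0" "e > 0"
    and g: "\<And>\<tau> e. \<tau> > 0 \<Longrightarrow> e > 0 \<Longrightarrow> g \<tau> e = f \<tau> (S_hat E \<tau> e)"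
  defines "S \<equiv> S_hat E \<tau> e"
  shows "pd1 g \<tau> e = pd1 f \<tau> S + pd2 f \<tau> S * P \<tau> S / T \<tau> S" "pd2 g \<tau> e = pd2 f \<tau> S / T \<tau> S"
proof -
  have op: "open ({0<..} \<times> {0<..} :: (real \<times> real) set)" by (intro open_Times) auto
  note cong = pd_cong_open[OF op, where f = g and g = "\<lambda>\<tau> e. f \<tau> (S_hat E \<tau> e)"]
  note der = pd_has_derivative(3,4)[where f = "\<lambda>\<tau> e. f \<tau> (S_hat E \<tau> e)",
      OF thermodynamic_has_derivative[OF f pos]]
  show "pd1 g \<tau> e = pd1 f \<tau> S + pd2 f \<tau> S * P \<tau> S / T \<tau> S" "pd2 g \<tau> e = pd2 f \<tau> S / T \<tau> S"
    using cong[of \<tau> e] der g pos by (simp_all add: S_def)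
qed

text \<open>The entropy satisfies \<open>S\<^sub>\<tau> = p/T\<close> and \<open>S\<^sub>e = 1/T\<close>, so \<open>\<partial>\<^sub>\<tau> - p \<partial>\<^sub>e\<close> annihilates it.\<close>

lemma isentropic_deriv_thermodynamic:
  assumes "smooth_eos f" "\<tau> > 0" "e > 0"
    and "\<And>\<tau> e. \<tau> > 0 \<Longrightarrow> e > 0 \<Longrightarrow> g \<tau> e = f \<tau> (S_hat E \<tau> e)"
  shows "isentropic_deriv E g \<tau> e = pd1 f \<tau> (S_hat E \<tau> e)"
  using pd_thermodynamic[where f = f and g = g, OF assms] by (simp add: isentropic_deriv_def p_hat_def)

lemma pressure_law: "pressure_law_conditions E"
  unfolding pressure_law_conditions_def
proof (intro allI impI)
  fix \<tau> e :: real assume pos: "\<tau> > 0" "e > 0"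
  define S where "S = S_hat E \<tau> e"
  have 1: "isentropic_deriv E (p_hat E) \<tau> e = - Q \<tau> (S_hat E \<tau> e)" if "\<tau> > 0" "e > 0" for \<tau> e
    using isentropic_deriv_thermodynamic[OF smooth_P that, of "p_hat E"] by (simp add: p_hat_def Q_def)
  have "((\<lambda>t. - Q t S) has_real_derivative - pd1 Q \<tau> S) (at \<tau>)"
    by (intro DERIV_minus Q_deriv_volume pos)
  then have "pd1 (\<lambda>\<tau> S. - Q \<tau> S) \<tau> S = - pd1 Q \<tau> S"
    unfolding pd1_def by (rule DERIV_imp_deriv)
  then have "isentropic_deriv E (isentropic_deriv E (p_hat E)) \<tau> e = - pd1 Q \<tau> S"
    using isentropic_deriv_thermodynamic[where f = "\<lambda>\<tau> S. - Q \<tau> S" and g = "isentropic_deriv E (p_hat E)",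
      OF smooth_eos_uminus[OF smooth_Q] pos 1] by (simp add: S_def)
  moreover have "pd2 (p_hat E) \<tau> e = pd2 P \<tau> S / T \<tau> S"
    using pd_thermodynamic(2)[OF smooth_P pos, of "p_hat E"] by (simp add: p_hat_def S_def)
  moreover have "p_hat E \<tau> e = P \<tau> S" by (simp add: p_hat_def S_def)
  ultimately show "p_hat E \<tau> e > 0 \<and> isentropic_deriv E (p_hat E) \<tau> e < 0 \<and>
      isentropic_deriv E (isentropic_deriv E (p_hat E)) \<tau> e > 0 \<and> pd2 (p_hat E) \<tau> e > 0"
    using signs[OF pos(1), of S] 1[OF pos] by (simp add: S_def[symmetric])
qed

text \<open>The hypograph of the entropy is the epigraph of the convex energy, since \<open>E\<close> increases in \<open>S\<close>.\<close>

lemma S_hat_concave: "concave_on ({0<..} \<times> {0<..}) (\<lambda>(\<tau>, e). S_hat E \<tau> e)"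
  unfolding concave_on_iff
proof (intro conjI ballI allI impI)
  show "convex ({0<..} \<times> {0<..} :: (real \<times> real) set)" by (intro convex_Times) auto
  fix y z :: "real \<times> real" and u v :: real
  assume yz: "y \<in> {0<..} \<times> {0<..}" "z \<in> {0<..} \<times> {0<..}" and uv: "u \<ge> 0" "v \<ge> 0" "u + v = 1"
  obtain a e b d where y: "y = (a, e)" and z: "z = (b, d)" by (cases y, cases z) auto
  have pos: "a > 0" "b > 0" "e > 0" "d > 0" using yz by (auto simp: y z)
  let ?S = "S_hat E a e" and ?R = "S_hat E b d"
  have c: "u * a + v * b > 0" "u * e + v * d > 0" using pos uv
    by (metis add_nonneg_pos add_pos_nonneg less_eq_real_def mult_nonneg_nonneg mult_pos_pos mult_zero_left zero_neq_one add_0)+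
  have "E (u * a + v * b) (u * ?S + v * ?R) \<le> u * E a ?S + v * E b ?R"
    using energy_convex pos uv unfolding convex_on_def by fastforce
  also have "\<dots> = E (u * a + v * b) (S_hat E (u * a + v * b) (u * e + v * d))"
    using E_S_hat pos c by simp
  finally have "u * ?S + v * ?R \<le> S_hat E (u * a + v * b) (u * e + v * d)"
    using E_less_iff[OF c(1)] by (meson not_le)
  then show "u * (case y of (\<tau>, e) \<Rightarrow> S_hat E \<tau> e) + v * (case z of (\<tau>, e) \<Rightarrow> S_hat E \<tau> e)
      \<le> (case u *\<^sub>R y + v *\<^sub>R z of (\<tau>, e) \<Rightarrow> S_hat E \<tau> e)"
    by (simp add: y z)
qed

end

section \<open>The characteristic fields of the Euler equations\<close>

lemma has_derivative_vector_3:
  fixes a b c :: "'a::real_normed_vector \<Rightarrow> real"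
  assumes "(a has_derivative a') (at x)" "(b has_derivative b') (at x)" "(c has_derivative c') (at x)"
  shows "((\<lambda>x. vector [a x, b x, c x] :: real ^ 3) has_derivative (\<lambda>h. vector [a' h, b' h, c' h])) (at x)"
proof -
  have vec: "(vector [p, q, r] :: real ^ 3) = p *\<^sub>R axis 1 1 + q *\<^sub>R axis 2 1 + r *\<^sub>R axis 3 1" for p q r
    by (simp add: vec_eq_iff forall_3 axis_def)
  show ?thesis unfolding vec
    by (intro has_derivative_add has_derivative_scaleR_left assms)
qed

lemma has_derivative_nth [derivative_intros]:
  "((\<lambda>U :: real ^ 3. U $ i) has_derivative (\<lambda>h. h $ i)) (at U)"
  by (rule bounded_linear_imp_has_derivative[OF bounded_linear_vec_nth])

lemma vec3_eq_iff: "(x :: 'a ^ 3) = y \<longleftrightarrow> x $ 1 = y $ 1 \<and> x $ 2 = y $ 2 \<and> x $ 3 = y $ 3"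
  by (simp add: vec_eq_iff forall_3)

lemma open_states: "open states"
proof -
  have "states = {U. 0 < U $ 1} \<inter> {U. 0 < U $ 3}" by (auto simp: states_def)
  moreover have "open ({U. 0 < U $ 1} \<inter> {U :: real ^ 3. 0 < U $ 3})"
    by (intro open_Int open_Collect_less continuous_intros)
  ultimately show ?thesis by simp
qed

lemma f0_has_derivative:
  "(f0 has_derivative (\<lambda>h. vector [h $ 1, h $ 2, h $ 3 + U $ 2 * h $ 2])) (at U)"
  unfolding f0_def[abs_def]
  by (intro has_derivative_vector_3) (auto intro!: derivative_eq_intros)

lemma A0_entries:
  "A0 U = vector [vector [1, 0, 0], vector [0, 1, 0], vector [0, U $ 2, 1]]"
proof -
  have "frechet_derivative f0 (at U) = (\<lambda>h. vector [h $ 1, h $ 2, h $ 3 + U $ 2 * h $ 2])"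
    using f0_has_derivative by (rule frechet_derivative_at[symmetric])
  then show ?thesis
    by (simp add: A0_def jacobian_def matrix_def vec3_eq_iff axis_def)
qed

lemma A0_mult: "A0 U *v h = vector [h $ 1, h $ 2, h $ 3 + U $ 2 * h $ 2]"
  by (simp add: A0_entries matrix_vector_mult_def vec3_eq_iff sum_3)

lemma invertible_A0: "invertible (A0 U)"
  by (simp add: invertible_det_nz det_3 A0_entries)

context gas
begin

lemma state_has_derivative:
  assumes f: "smooth_eos f" and U: "U \<in> states"
  defines "\<tau> \<equiv> U $ 1" and "S \<equiv> S_state E U"
  shows "((\<lambda>U. f (U $ 1) (S_state E U)) has_derivative
     (\<lambda>h. (pd1 f \<tau> S + pd2 f \<tau> S * P \<tau> S / T \<tau> S) * h $ 1 + pd2 f \<tau> S / T \<tau> S * h $ 3)) (at U)"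
proof -
  have pos: "U $ 1 > 0" "U $ 3 > 0" using U by (auto simp: states_def)
  have "((\<lambda>U :: real ^ 3. (U $ 1, U $ 3)) has_derivative (\<lambda>h. (h $ 1, h $ 3))) (at U)"
    by (intro has_derivative_Pair has_derivative_nth)
  from has_derivative_compose[OF this thermodynamic_has_derivative[OF f pos]]
  show ?thesis by (simp add: S_state_def \<tau>_def S_def)
qed

lemma state_continuous:
  assumes f: "smooth_eos f" and U: "U \<in> states"
  shows "isCont (\<lambda>U. f (U $ 1) (S_state E U)) U"
  using state_has_derivative[OF assms] by (rule has_derivative_continuous)

abbreviation "Qs U \<equiv> Q (U $ 1) (S_state E U)"

lemma sound_speed_eq: "sound_speed E U = sqrt (Qs U)"
  by (simp add: sound_speed_def Q_def)

lemma state_signs: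
  assumes "U \<in> states"
  shows "sound_speed E U > 0" "(sound_speed E U)\<^sup>2 = Qs U" "Qs U > 0"
    "T (U $ 1) (S_state E U) > 0"
  using assms signs(3,4)[of "U $ 1" "S_state E U"]
  by (auto simp: sound_speed_eq states_def)

lemma p_state_eq: "p_state E U = P (U $ 1) (S_state E U)"
  by (simp add: p_state_def p_hat_def S_state_def)

lemma E_S_state: "U \<in> states \<Longrightarrow> E (U $ 1) (S_state E U) = U $ 3"
  by (simp add: S_state_def E_S_hat states_def)

abbreviation "p\<^sub>\<tau> U \<equiv> pd1 (p_hat E) (U $ 1) (U $ 3)"
abbreviation "p\<^sub>e U \<equiv> pd2 (p_hat E) (U $ 1) (U $ 3)"

lemma pd_p_hat_state:
  assumes "U \<in> states"
  defines "\<tau> \<equiv> U $ 1" and "S \<equiv> S_state E U"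
  shows "p\<^sub>\<tau> U = - Q \<tau> S + pd2 P \<tau> S * P \<tau> S / T \<tau> S" "p\<^sub>e U = pd2 P \<tau> S / T \<tau> S"
  using pd_thermodynamic[OF smooth_P, of "U $ 1" "U $ 3" "p_hat E"] assms(1)
  by (simp_all add: p_hat_def S_def S_state_def \<tau>_def states_def Q_def)

lemma sound_speed_p_hat: "U \<in> states \<Longrightarrow> p_state E U * p\<^sub>e U - p\<^sub>\<tau> U = Qs U"
  by (simp add: pd_p_hat_state p_state_eq)

lemma p_state_has_derivative:
  assumes "U \<in> states"
  shows "(p_state E has_derivative (\<lambda>h. p\<^sub>\<tau> U * h $ 1 + p\<^sub>e U * h $ 3)) (at U)"
  using state_has_derivative[OF smooth_P assms] pd_p_hat_state[OF assms]
  unfolding p_state_eq[abs_def] Q_def by simp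

lemma A1_entries:
  assumes "U \<in> states"
  shows "A1 E U = vector [vector [0, -1, 0], vector [p\<^sub>\<tau> U, 0, p\<^sub>e U],
    vector [U $ 2 * p\<^sub>\<tau> U, p_state E U, U $ 2 * p\<^sub>e U]]"
proof -
  have "(f1 E has_derivative (\<lambda>h. vector [- h $ 2, p\<^sub>\<tau> U * h $ 1 + p\<^sub>e U * h $ 3,
      h $ 2 * p_state E U + U $ 2 * (p\<^sub>\<tau> U * h $ 1 + p\<^sub>e U * h $ 3)])) (at U)"
    unfolding f1_def[abs_def]
    by (intro has_derivative_vector_3)
      (auto intro!: derivative_eq_intros p_state_has_derivative assms)
  then have "frechet_derivative (f1 E) (at U) = (\<lambda>h. vector [- h $ 2, p\<^sub>\<tau> U * h $ 1 + p\<^sub>e U * h $ 3,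
      h $ 2 * p_state E U + U $ 2 * (p\<^sub>\<tau> U * h $ 1 + p\<^sub>e U * h $ 3)])"
    by (rule frechet_derivative_at[symmetric])
  then show ?thesis
    by (simp add: A1_def jacobian_def matrix_def vec3_eq_iff axis_def)
qed

lemma A1_mult:
  assumes "U \<in> states"
  shows "A1 E U *v h = vector [- h $ 2, p\<^sub>\<tau> U * h $ 1 + p\<^sub>e U * h $ 3,
    U $ 2 * (p\<^sub>\<tau> U * h $ 1 + p\<^sub>e U * h $ 3) + p_state E U * h $ 2]"
  by (simp add: A1_entries[OF assms] matrix_vector_mult_def vec3_eq_iff sum_3 algebra_simps)

lemma char_poly:
  assumes "U \<in> states"
  shows "euler_char_poly E U = [:0, Qs U, 0, -1:]"
  unfolding euler_char_poly_def det_3 sound_speed_p_hat[OF assms, symmetric]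
  by (simp add: A0_entries A1_entries[OF assms] algebra_simps)

lemma char_speeds_eq:
  assumes "U \<in> states"
  shows "char_speeds E U = {- sound_speed E U, 0, sound_speed E U}"
proof -
  have "poly (euler_char_poly E U) l = l * (sound_speed E U - l) * (sound_speed E U + l)" for l
    by (simp add: char_poly[OF assms] state_signs(2)[OF assms, symmetric] algebra_simps power2_eq_square)
  then show ?thesis by (auto simp: char_speeds_def)
qed

lemma Max_char_speeds: "U \<in> states \<Longrightarrow> Max (char_speeds E U) = sound_speed E U"
  and Min_char_speeds: "U \<in> states \<Longrightarrow> Min (char_speeds E U) = - sound_speed E U"
  using state_signs(1)[of U] by (auto simp: char_speeds_eq)

text \<open>The derivative of \<open>l (c\<^sup>2 - l\<^sup>2)\<close> at \<open>l = c\<close> or \<open>l = - c\<close> is \<open>- 2 c\<^sup>2\<close>.\<close>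

lemma order_char_poly:
  assumes U: "U \<in> states" and l: "l\<^sup>2 = Qs U"
  shows "order l (euler_char_poly E U) = 1"
proof -
  let ?p = "euler_char_poly E U"
  have p: "?p \<noteq> 0" "poly ?p l = 0"
    using l by (simp_all add: char_poly[OF U] power2_eq_square)
  have d: "pderiv ?p = [:Qs U, 0, -3:]"
    by (simp add: char_poly[OF U] pderiv_pCons)
  have "poly (pderiv ?p) l = - 2 * Qs U"
    unfolding d using l by (simp add: power2_eq_square)
  then have "poly (pderiv ?p) l \<noteq> 0" using state_signs(3)[OF U] by simp
  then have "order l (pderiv ?p) = 0" by (rule order_0I)
  moreover have "pderiv ?p \<noteq> 0" "order l ?p \<noteq> 0" using d p by (auto simp: order_root)
  ultimately show ?thesis using order_pderiv[of ?p l] p by simp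
qed

lemma sound_speed_has_derivative:
  assumes U: "U \<in> states"
  defines "\<tau> \<equiv> U $ 1" and "S \<equiv> S_state E U"
  shows "(sound_speed E has_derivative (\<lambda>h. ((pd1 Q \<tau> S + pd2 Q \<tau> S * P \<tau> S / T \<tau> S) * h $ 1
     + pd2 Q \<tau> S / T \<tau> S * h $ 3) / (2 * sound_speed E U))) (at U)"
  unfolding sound_speed_eq[abs_def] \<tau>_def S_def
  by (rule derivative_eq_intros state_has_derivative smooth_Q U refl state_signs(3)[OF U]
      | simp add: field_simps)+

text \<open>An eigenvector for \<open>c\<close> or \<open>- c\<close> satisfies \<open>r\<^sub>3 = - p r\<^sub>1\<close>, so the derivative of the speed along it is the isentropic derivative of \<open>c\<close> times \<open>r\<^sub>1\<close>, which is a nonzero multiple of \<open>p\<^sub>\<tau>\<^sub>\<tau>\<close>.\<close>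

lemma acoustic_field_nonlinear:
  assumes lam: "\<And>U. U \<in> states \<Longrightarrow> lam U = s * sound_speed E U" and s: "s = 1 \<or> s = - 1"
  shows "genuinely_nonlinear E lam"
  unfolding genuinely_nonlinear_def
proof (intro ballI conjI allI impI)
  fix U assume U: "U \<in> states"
  define \<tau> S where "\<tau> = U $ 1" and "S = S_state E U"
  define D where "D h = s * (((pd1 Q \<tau> S + pd2 Q \<tau> S * P \<tau> S / T \<tau> S) * h $ 1
     + pd2 Q \<tau> S / T \<tau> S * h $ 3) / (2 * sound_speed E U))" for h :: "real ^ 3"
  have "((\<lambda>U. s * sound_speed E U) has_derivative D) (at U)"
    unfolding D_def \<tau>_def S_def by (intro has_derivative_mult_right sound_speed_has_derivative U)
  then have der: "(lam has_derivative D) (at U)"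
    by (rule has_derivative_transform_within_open[OF _ open_states U]) (simp add: lam)
  then show "lam differentiable (at U)" by (auto simp: differentiable_def)
  fix r :: "real ^ 3"
  assume r: "r \<noteq> 0 \<and> A1 E U *v r = lam U *s (A0 U *v r)"
  then have r': "A1 E U *v r = lam U *s (A0 U *v r)" by blast
  have nz: "lam U \<noteq> 0" using lam[OF U] s state_signs(1)[OF U] by auto
  have eqs: "- r $ 2 = lam U * r $ 1" "p\<^sub>\<tau> U * r $ 1 + p\<^sub>e U * r $ 3 = lam U * r $ 2"
    "U $ 2 * (p\<^sub>\<tau> U * r $ 1 + p\<^sub>e U * r $ 3) + p_state E U * r $ 2 = lam U * (r $ 3 + U $ 2 * r $ 2)"
    using arg_cong[OF r', of "\<lambda>x. x $ 1"] arg_cong[OF r', of "\<lambda>x. x $ 2"] arg_cong[OF r', of "\<lambda>x. x $ 3"]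
    by (simp_all only: A1_mult[OF U] A0_mult vector_3 vector_smult_component)
  have r2: "r $ 2 = - lam U * r $ 1" using eqs(1) by simp
  have "lam U * r $ 3 = p_state E U * r $ 2"
    using eqs(3) unfolding eqs(2) by (simp add: algebra_simps)
  then have "lam U * r $ 3 = lam U * (- p_state E U * r $ 1)" unfolding r2 by simp
  then have r3: "r $ 3 = - p_state E U * r $ 1" using nz by (metis mult_left_cancel)
  have r1: "r $ 1 \<noteq> 0"
  proof
    assume "r $ 1 = 0"
    then have "r = 0" using r2 r3 by (simp add: vec3_eq_iff)
    then show False using r by simp
  qed
  have "D r = s * (pd1 Q \<tau> S * r $ 1 / (2 * sound_speed E U))"
    unfolding D_def r3 p_state_eq by (simp add: \<tau>_def S_def algebra_simps)
  moreover have "pd1 Q \<tau> S < 0" using U by (intro signs) (simp add: \<tau>_def states_def)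
  ultimately have "D r \<noteq> 0" using r1 s state_signs(1)[OF U] by auto
  then show "frechet_derivative lam (at U) r \<noteq> 0"
    using frechet_derivative_at[OF der] by simp
qed

lemma extreme_fields: "extreme_fields_nondegenerate E"
proof -
  have "simple_speed E lam \<and> genuinely_nonlinear E lam"
    if lam: "\<And>U. U \<in> states \<Longrightarrow> lam U = s * sound_speed E U" and s: "s = 1 \<or> s = - 1" for lam s
  proof
    have "(lam U)\<^sup>2 = Qs U" if "U \<in> states" for U
      using lam[OF that] s state_signs(2)[OF that] by (auto simp: power_mult_distrib)
    moreover have "lam U \<in> char_speeds E U" if "U \<in> states" for U
      using lam[OF that] s by (auto simp: char_speeds_eq[OF that])
    ultimately show "simple_speed E lam"
      using order_char_poly by (auto simp: simple_speed_def char_poly)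
    show "genuinely_nonlinear E lam" using lam s by (rule acoustic_field_nonlinear)
  qed
  from this[of "\<lambda>U. Max (char_speeds E U)" 1] this[of "\<lambda>U. Min (char_speeds E U)" "-1"]
  show ?thesis by (simp add: extreme_fields_nondegenerate_def Max_char_speeds Min_char_speeds)
qed

lemma entropy_pair_S: "entropy_pair E (S_state E) (\<lambda>U. 0)"
  unfolding entropy_pair_def
proof (intro ballI conjI allI)
  fix U h :: "real ^ 3" assume U: "U \<in> states"
  let ?P = "p_state E U" and ?T = "T (U $ 1) (S_state E U)"
  have pos: "U $ 1 > 0" "U $ 3 > 0" using U by (auto simp: states_def)
  have "((\<lambda>U :: real ^ 3. (U $ 1, U $ 3)) has_derivative (\<lambda>h. (h $ 1, h $ 3))) (at U)"
    by (intro has_derivative_Pair has_derivative_nth)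
  from has_derivative_compose[OF this S_hat_has_derivative[OF pos]]
  have der: "(S_state E has_derivative (\<lambda>h. (?P * h $ 1 + h $ 3) / ?T)) (at U)"
    by (simp add: S_state_def[abs_def] p_state_def p_hat_def)
  then show "S_state E differentiable (at U)" by (auto simp: differentiable_def)
  show "(\<lambda>U :: real ^ 3. 0 :: real) differentiable (at U)" by simp
  define w where "w = matrix_inv (A0 U) *v (A1 E U *v h)"
  have "A0 U ** matrix_inv (A0 U) = mat 1"
    using someI_ex[OF invertible_A0[of U, unfolded invertible_def]] by (simp add: matrix_inv_def)
  then have Aw: "A0 U *v w = A1 E U *v h"
    unfolding w_def by (metis matrix_vector_mul_assoc matrix_vector_mul_lid)
  have eqs: "w $ 1 = - h $ 2" "w $ 2 = p\<^sub>\<tau> U * h $ 1 + p\<^sub>e U * h $ 3"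
    "w $ 3 + U $ 2 * w $ 2 = U $ 2 * (p\<^sub>\<tau> U * h $ 1 + p\<^sub>e U * h $ 3) + ?P * h $ 2"
    using arg_cong[OF Aw, of "\<lambda>x. x $ 1"] arg_cong[OF Aw, of "\<lambda>x. x $ 2"] arg_cong[OF Aw, of "\<lambda>x. x $ 3"]
    by (simp_all only: A1_mult[OF U] A0_mult vector_3)
  have "w $ 3 = ?P * h $ 2" using eqs(3) unfolding eqs(2) by simp
  then have "(?P * w $ 1 + w $ 3) / ?T = 0" using eqs(1) by simp
  then show "frechet_derivative (S_state E) (at U) (matrix_inv (A0 U) *v (A1 E U *v h))
      = frechet_derivative (\<lambda>U. 0) (at U) h"
    unfolding w_def[symmetric] by (simp add: frechet_derivative_at[OF der, symmetric])
qed

lemma concave_entropy: "global_concave_entropy E"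
  unfolding global_concave_entropy_def using ex1_entropy entropy_pair_S S_hat_concave by blast

section \<open>Lax shocks and the forward Hugoniot curves\<close>

text \<open>The Rankine-Hugoniot conditions give \<open>[v]\<^sup>2 = - [p] [\<tau>]\<close>, and \<open>[v] < 0\<close> for Lax shocks of either family.  This expression is continuous where the jumps vanish, unlike the shock speed as a quotient.\<close>

definition velocity_jump :: "real \<Rightarrow> real \<Rightarrow> real \<Rightarrow> real \<Rightarrow> real" where
  "velocity_jump \<tau>0 S0 \<tau> S = sqrt (- (P \<tau> S - P \<tau>0 S0) * (\<tau> - \<tau>0))"

text \<open>Given the first two conditions, the kinetic energy cancels from the third and leaves the Hugoniot relation.\<close>

lemma rankine_hugoniot_iff:
  assumes "Um \<in> states" "Up \<in> states"
  shows "rankine_hugoniot E Um Up \<sigma> \<longleftrightarrow>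
     \<sigma> * (Up $ 1 - Um $ 1) = - (Up $ 2 - Um $ 2) \<and>
     \<sigma> * (Up $ 2 - Um $ 2) = p_state E Up - p_state E Um \<and>
     \<sigma> * (Up $ 3 - Um $ 3 + (p_state E Up + p_state E Um) / 2 * (Up $ 1 - Um $ 1)) = 0"
proof -
  let ?dt = "Up $ 1 - Um $ 1" and ?dv = "Up $ 2 - Um $ 2" and ?de = "Up $ 3 - Um $ 3"
  let ?p = "p_state E Up" and ?q = "p_state E Um" and ?v = "Up $ 2" and ?w = "Um $ 2"
  have "rankine_hugoniot E Um Up \<sigma> \<longleftrightarrow> \<sigma> * ?dt = - ?dv \<and> \<sigma> * ?dv = ?p - ?q \<and>
      \<sigma> * (?de + (?v\<^sup>2 - ?w\<^sup>2) / 2) = ?v * ?p - ?w * ?q"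
    by (simp add: rankine_hugoniot_def f0_def f1_def vec3_eq_iff algebra_simps diff_divide_distrib)
  moreover have "\<sigma> * (?de + (?v\<^sup>2 - ?w\<^sup>2) / 2) - (?v * ?p - ?w * ?q) = \<sigma> * (?de + (?p + ?q) / 2 * ?dt)"
    if 1: "\<sigma> * ?dt = - ?dv" and 2: "\<sigma> * ?dv = ?p - ?q"
  proof -
    have "\<sigma> * ((?v\<^sup>2 - ?w\<^sup>2) / 2) = (\<sigma> * ?dv) * ((?v + ?w) / 2)"
      by (simp add: field_simps power2_eq_square)
    then have "\<sigma> * ((?v\<^sup>2 - ?w\<^sup>2) / 2) = (?p - ?q) * ((?v + ?w) / 2)" unfolding 2 .
    moreover have "\<sigma> * ((?p + ?q) / 2 * ?dt) = (\<sigma> * ?dt) * ((?p + ?q) / 2)" by (simp add: field_simps)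
    then have "\<sigma> * ((?p + ?q) / 2 * ?dt) = - ?dv * ((?p + ?q) / 2)" unfolding 1 .
    ultimately show ?thesis unfolding distrib_left by (simp add: field_simps)
  qed
  ultimately show ?thesis by force
qed

lemma rankine_hugoniot_states:
  assumes st: "Um \<in> states" "Up \<in> states" and ne: "Up $ 1 \<noteq> Um $ 1" "\<sigma> \<noteq> 0"
  shows "rankine_hugoniot E Um Up \<sigma> \<longleftrightarrow>
     hugoniot (Um $ 1) (S_state E Um) (Up $ 1) (S_state E Up) = 0 \<and>
     \<sigma>\<^sup>2 = speed_sq (Um $ 1) (S_state E Um) (Up $ 1) (S_state E Up) \<and>
     Up $ 2 = Um $ 2 - \<sigma> * (Up $ 1 - Um $ 1)"
proof -
  let ?dt = "Up $ 1 - Um $ 1"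
  have v: "\<sigma> * ?dt = - (Up $ 2 - Um $ 2) \<longleftrightarrow> Up $ 2 = Um $ 2 - \<sigma> * ?dt"
    by (intro iffI; linarith)
  have p: "\<sigma> * (Up $ 2 - Um $ 2) = p_state E Up - p_state E Um \<longleftrightarrow>
      \<sigma>\<^sup>2 = speed_sq (Um $ 1) (S_state E Um) (Up $ 1) (S_state E Up)"
    if "Up $ 2 = Um $ 2 - \<sigma> * ?dt"
  proof -
    have "\<sigma> * (Up $ 2 - Um $ 2) = - (\<sigma>\<^sup>2 * ?dt)" using that by (simp add: power2_eq_square)
    moreover have "\<sigma>\<^sup>2 = speed_sq (Um $ 1) (S_state E Um) (Up $ 1) (S_state E Up) \<longleftrightarrow>
        \<sigma>\<^sup>2 * ?dt = - (p_state E Up - p_state E Um)"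
      unfolding speed_sq_def p_state_eq using ne by (intro eq_divide_eq[THEN trans]) simp
    ultimately show ?thesis by auto
  qed
  have h: "\<sigma> * (Up $ 3 - Um $ 3 + (p_state E Up + p_state E Um) / 2 * ?dt) = 0 \<longleftrightarrow>
      hugoniot (Um $ 1) (S_state E Um) (Up $ 1) (S_state E Up) = 0"
    unfolding hugoniot_def E_S_state[OF st(1)] E_S_state[OF st(2)] p_state_eq[symmetric]
    using ne by simp
  show ?thesis
    unfolding rankine_hugoniot_iff[OF st] h v using p by blast
qed

lemma lax_shock_volume_ne:
  assumes "lax_shock E k Um Up \<sigma>"
  shows "Up $ 1 \<noteq> Um $ 1"
proof
  assume eq: "Up $ 1 = Um $ 1"
  have st: "Um \<in> states" "Up \<in> states" and rh: "rankine_hugoniot E Um Up \<sigma>" and \<sigma>: "\<sigma> \<noteq> 0"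
    using assms by (auto simp: lax_shock_def)
  from rh have "Up $ 2 = Um $ 2" "Up $ 3 = Um $ 3"
    unfolding rankine_hugoniot_iff[OF st] using eq \<sigma> by simp_all
  with eq have "Up = Um" by (simp add: vec3_eq_iff)
  with assms show False by (auto simp: lax_shock_def)
qed

lemma velocity_jump_eq:
  assumes "\<tau> \<noteq> \<tau>0"
  shows "velocity_jump \<tau>0 S0 \<tau> S = sqrt (speed_sq \<tau>0 S0 \<tau> S) * \<bar>\<tau> - \<tau>0\<bar>"
proof -
  have "- (P \<tau> S - P \<tau>0 S0) * (\<tau> - \<tau>0) = speed_sq \<tau>0 S0 \<tau> S * (\<tau> - \<tau>0)\<^sup>2"
    using assms by (simp add: speed_sq_def power2_eq_square)
  then show ?thesis unfolding velocity_jump_def by (simp add: real_sqrt_mult)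
qed

text \<open>The Lax inequalities and the compression conditions determine each other on the Hugoniot curve; the latter are easier to parametrize.\<close>

lemma lax_shock_1_iff:
  "lax_shock E 1 Um Up \<sigma> \<longleftrightarrow> Um \<in> states \<and> Up \<in> states \<and>
     Up $ 1 < Um $ 1 \<and> S_state E Um < S_state E Up \<and>
     hugoniot (Um $ 1) (S_state E Um) (Up $ 1) (S_state E Up) = 0 \<and>
     \<sigma> = - sqrt (speed_sq (Um $ 1) (S_state E Um) (Up $ 1) (S_state E Up)) \<and>
     Up $ 2 = Um $ 2 - velocity_jump (Um $ 1) (S_state E Um) (Up $ 1) (S_state E Up)"
  (is "_ \<longleftrightarrow> ?R")
proof (cases "Um \<in> states \<and> Up \<in> states")
  case False then show ?thesis by (auto simp: lax_shock_def)
next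
  case True
  then have st: "Um \<in> states" "Up \<in> states" by auto
  then have pos: "Um $ 1 > 0" "Up $ 1 > 0" by (auto simp: states_def)
  let ?m = "speed_sq (Um $ 1) (S_state E Um) (Up $ 1) (S_state E Up)"
  note signs = state_signs[OF st(1)] state_signs[OF st(2)]
  show ?thesis
  proof
    assume lax: "lax_shock E 1 Um Up \<sigma>"
    have ne: "Up $ 1 \<noteq> Um $ 1" using lax by (rule lax_shock_volume_ne)
    have \<sigma>: "\<sigma> < - sound_speed E Um" "- sound_speed E Up < \<sigma>" "\<sigma> < 0" "rankine_hugoniot E Um Up \<sigma>"
      using lax by (auto simp: lax_shock_def)
    with rankine_hugoniot_states[OF st ne] have rh: "\<sigma>\<^sup>2 = ?m"
      "hugoniot (Um $ 1) (S_state E Um) (Up $ 1) (S_state E Up) = 0"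
      "Up $ 2 = Um $ 2 - \<sigma> * (Up $ 1 - Um $ 1)" by auto
    have "(sound_speed E Um)\<^sup>2 < (- \<sigma>)\<^sup>2"
      using \<sigma> signs(1) by (intro power_strict_mono) auto
    then have "Qs Um < ?m" using rh signs by simp
    from lax_imp_compressive[OF pos(2,1) ne rh(2) this]
    have comp: "Up $ 1 < Um $ 1" "S_state E Um < S_state E Up" .
    have sq: "\<sigma> = - sqrt ?m" using \<sigma>(3) by (simp add: rh(1)[symmetric])
    have "velocity_jump (Um $ 1) (S_state E Um) (Up $ 1) (S_state E Up) = \<sigma> * (Up $ 1 - Um $ 1)"
      unfolding velocity_jump_eq[OF ne] sq using comp by (simp add: algebra_simps)
    with comp rh sq st show ?R by simp
  next
    assume R: ?R
    then have ne: "Up $ 1 \<noteq> Um $ 1" by simp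
    have m: "Qs Um < ?m" "?m < Qs Up"
      using speed_sq_between_sound_speeds[OF pos(2)] R by auto
    have \<sigma>: "\<sigma> = - sqrt ?m" using R by simp
    have "\<sigma> < 0" "\<sigma>\<^sup>2 = ?m" using m signs by (auto simp: \<sigma>)
    moreover have "velocity_jump (Um $ 1) (S_state E Um) (Up $ 1) (S_state E Up) = \<sigma> * (Up $ 1 - Um $ 1)"
      unfolding velocity_jump_eq[OF ne] \<sigma> using R by (simp add: algebra_simps)
    ultimately have "rankine_hugoniot E Um Up \<sigma>"
      using R unfolding rankine_hugoniot_states[OF st ne less_imp_neq[OF \<open>\<sigma> < 0\<close>]] by simp
    then show "lax_shock E 1 Um Up \<sigma>"
      using st m \<open>\<sigma> < 0\<close> unfolding lax_shock_def by (simp add: \<sigma> sound_speed_eq)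
  qed
qed

text \<open>The same with the roles of the two states exchanged: now the left state is the compressed one.\<close>

lemma lax_shock_3_iff:
  "lax_shock E 3 Um Up \<sigma> \<longleftrightarrow> Um \<in> states \<and> Up \<in> states \<and>
     Um $ 1 < Up $ 1 \<and> S_state E Up < S_state E Um \<and>
     hugoniot (Um $ 1) (S_state E Um) (Up $ 1) (S_state E Up) = 0 \<and>
     \<sigma> = sqrt (speed_sq (Um $ 1) (S_state E Um) (Up $ 1) (S_state E Up)) \<and>
     Up $ 2 = Um $ 2 - velocity_jump (Um $ 1) (S_state E Um) (Up $ 1) (S_state E Up)"
  (is "_ \<longleftrightarrow> ?R")
proof (cases "Um \<in> states \<and> Up \<in> states")
  case False then show ?thesis by (auto simp: lax_shock_def)
next
  case True
  then have st: "Um \<in> states" "Up \<in> states" by auto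
  then have pos: "Um $ 1 > 0" "Up $ 1 > 0" by (auto simp: states_def)
  let ?m = "speed_sq (Um $ 1) (S_state E Um) (Up $ 1) (S_state E Up)"
  note signs = state_signs[OF st(1)] state_signs[OF st(2)]
  have sym: "speed_sq (Up $ 1) (S_state E Up) (Um $ 1) (S_state E Um) = ?m"
    "hugoniot (Up $ 1) (S_state E Up) (Um $ 1) (S_state E Um)
       = - hugoniot (Um $ 1) (S_state E Um) (Up $ 1) (S_state E Up)"
    by (rule speed_sq_sym, rule hugoniot_sym)
  show ?thesis
  proof
    assume lax: "lax_shock E 3 Um Up \<sigma>"
    have ne: "Up $ 1 \<noteq> Um $ 1" using lax by (rule lax_shock_volume_ne)
    have \<sigma>: "\<sigma> < sound_speed E Um" "sound_speed E Up < \<sigma>" "\<sigma> > 0" "rankine_hugoniot E Um Up \<sigma>"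
      using lax by (auto simp: lax_shock_def)
    with rankine_hugoniot_states[OF st ne] have rh: "\<sigma>\<^sup>2 = ?m"
      "hugoniot (Um $ 1) (S_state E Um) (Up $ 1) (S_state E Up) = 0"
      "Up $ 2 = Um $ 2 - \<sigma> * (Up $ 1 - Um $ 1)" by auto
    have "(sound_speed E Up)\<^sup>2 < \<sigma>\<^sup>2"
      using \<sigma> signs(5) by (intro power_strict_mono) auto
    then have "Qs Up < speed_sq (Up $ 1) (S_state E Up) (Um $ 1) (S_state E Um)"
      using rh signs sym by simp
    from lax_imp_compressive[OF pos ne[symmetric] _ this]
    have comp: "Um $ 1 < Up $ 1" "S_state E Up < S_state E Um" using sym rh by auto
    have sq: "\<sigma> = sqrt ?m" using \<sigma>(3) by (simp add: rh(1)[symmetric])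
    have "velocity_jump (Um $ 1) (S_state E Um) (Up $ 1) (S_state E Up) = \<sigma> * (Up $ 1 - Um $ 1)"
      unfolding velocity_jump_eq[OF ne] sq using comp by (simp add: algebra_simps)
    with comp rh sq st show ?R by simp
  next
    assume R: ?R
    then have ne: "Up $ 1 \<noteq> Um $ 1" by simp
    have m: "Qs Up < ?m" "?m < Qs Um"
      using speed_sq_between_sound_speeds[OF pos(1), of "Up $ 1" "S_state E Up" "S_state E Um"] R sym by auto
    have \<sigma>: "\<sigma> = sqrt ?m" using R by simp
    have "\<sigma> > 0" "\<sigma>\<^sup>2 = ?m" using m signs by (auto simp: \<sigma>)
    moreover have "velocity_jump (Um $ 1) (S_state E Um) (Up $ 1) (S_state E Up) = \<sigma> * (Up $ 1 - Um $ 1)"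
      unfolding velocity_jump_eq[OF ne] \<sigma> using R by (simp add: algebra_simps)
    moreover have "\<sigma> \<noteq> 0" using \<open>\<sigma> > 0\<close> by simp
    ultimately have "rankine_hugoniot E Um Up \<sigma>"
      using R unfolding rankine_hugoniot_states[OF st ne \<open>\<sigma> \<noteq> 0\<close>] by simp
    then show "lax_shock E 3 Um Up \<sigma>"
      using st m \<open>\<sigma> > 0\<close> unfolding lax_shock_def by (simp add: \<sigma> sound_speed_eq)
  qed
qed

text \<open>For \<open>S\<close> above the entropy of \<open>U\<close> these states form the forward 1-Hugoniot curve, below it the forward 3-Hugoniot curve.\<close>

definition hugoniot_state :: "real ^ 3 \<Rightarrow> real \<Rightarrow> real ^ 3" where
  "hugoniot_state U S = (let \<tau> = hugoniot_volume (U $ 1) (S_state E U) S in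
     vector [\<tau>, U $ 2 - velocity_jump (U $ 1) (S_state E U) \<tau> S, E \<tau> S])"

definition hugoniot_speed_sq :: "real ^ 3 \<Rightarrow> real \<Rightarrow> real" where
  "hugoniot_speed_sq U S = speed_sq (U $ 1) (S_state E U) (hugoniot_volume (U $ 1) (S_state E U) S) S"

lemma hugoniot_state_nth:
  "hugoniot_state U S $ 1 = hugoniot_volume (U $ 1) (S_state E U) S"
  "hugoniot_state U S $ 2 = U $ 2 - velocity_jump (U $ 1) (S_state E U) (hugoniot_volume (U $ 1) (S_state E U) S) S"
  "hugoniot_state U S $ 3 = E (hugoniot_volume (U $ 1) (S_state E U) S) S"
  by (simp_all add: hugoniot_state_def Let_def)

lemma hugoniot_state_in_states: "U \<in> states \<Longrightarrow> hugoniot_state U S \<in> states"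
  using hugoniot_volume_pos[of "U $ 1"] signs(1) by (simp add: states_def hugoniot_state_nth)

lemma S_hugoniot_state: "U \<in> states \<Longrightarrow> S_state E (hugoniot_state U S) = S"
  using hugoniot_volume_pos[of "U $ 1"] by (simp add: states_def hugoniot_state_nth S_state_def)

lemma hugoniot_state_self: "U \<in> states \<Longrightarrow> hugoniot_state U (S_state E U) = U"
  by (simp add: vec3_eq_iff hugoniot_state_nth velocity_jump_def E_S_state)

lemma hugoniot_state_1:
  assumes "U \<in> states" "S_state E U < S"
  shows "lax_shock E 1 U (hugoniot_state U S) (- sqrt (hugoniot_speed_sq U S))"
proof -
  have "U $ 1 > 0" using assms by (simp add: states_def)
  from hugoniot_volume_compressed(2,3)[OF this assms(2)] show ?thesis
    unfolding lax_shock_1_iff using assms hugoniot_state_in_states[OF assms(1), of S]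
    by (simp add: S_hugoniot_state hugoniot_state_nth hugoniot_speed_sq_def)
qed

lemma hugoniot_state_3:
  assumes "U \<in> states" "S < S_state E U"
  shows "lax_shock E 3 U (hugoniot_state U S) (sqrt (hugoniot_speed_sq U S))"
proof -
  have "U $ 1 > 0" using assms by (simp add: states_def)
  from hugoniot_volume_expanded(1,2)[OF this assms(2)] show ?thesis
    unfolding lax_shock_3_iff using assms hugoniot_state_in_states[OF assms(1), of S]
    by (simp add: S_hugoniot_state hugoniot_state_nth hugoniot_speed_sq_def)
qed

lemma lax_1_hugoniot_state:
  assumes "lax_shock E 1 U V \<sigma>"
  shows "S_state E U < S_state E V" "V = hugoniot_state U (S_state E V)"
proof -
  note lax = assms[unfolded lax_shock_1_iff]
  then have "hugoniot_volume (U $ 1) (S_state E U) (S_state E V) = V $ 1"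
    by (intro hugoniot_volume_unique) (auto simp: states_def)
  with lax show "S_state E U < S_state E V" "V = hugoniot_state U (S_state E V)"
    by (auto simp: vec3_eq_iff hugoniot_state_nth E_S_state)
qed

lemma lax_3_hugoniot_state:
  assumes "lax_shock E 3 U V \<sigma>"
  shows "S_state E V < S_state E U" "V = hugoniot_state U (S_state E V)"
proof -
  note lax = assms[unfolded lax_shock_3_iff]
  then have "hugoniot_volume (U $ 1) (S_state E U) (S_state E V) = V $ 1"
    by (intro hugoniot_volume_unique) (auto simp: states_def)
  with lax show "S_state E V < S_state E U" "V = hugoniot_state U (S_state E V)"
    by (auto simp: vec3_eq_iff hugoniot_state_nth E_S_state)
qed

lemma hugoniot_speed_sq_mono_1:
  assumes "U \<in> states" "S_state E U < S" "S < S'"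
  shows "hugoniot_speed_sq U S < hugoniot_speed_sq U S'"
  unfolding hugoniot_speed_sq_def using assms hugoniot_volume_compressed(1-3)[of "U $ 1" "S_state E U"]
  by (intro speed_sq_mono_compressed) (auto simp: states_def)

lemma hugoniot_speed_sq_mono_3:
  assumes "U \<in> states" "S' < S_state E U" "S < S'"
  shows "hugoniot_speed_sq U S < hugoniot_speed_sq U S'"
  unfolding hugoniot_speed_sq_def using assms hugoniot_volume_expanded(1-2)[of "U $ 1" _ "S_state E U"]
  by (intro speed_sq_mono_expanded) (auto simp: states_def)

lemma continuous_on_smooth_compose:
  assumes "smooth_eos f" "continuous_on A g" "\<And>x. x \<in> A \<Longrightarrow> g x > 0" "continuous_on A h"
  shows "continuous_on A (\<lambda>x. f (g x) (h x))"
proof -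
  have "continuous_on ({0<..} \<times> UNIV) (\<lambda>z. f (fst z) (snd z))"
  proof (intro continuous_at_imp_continuous_on ballI)
    fix z :: "real \<times> real" assume "z \<in> {0<..} \<times> UNIV"
    then show "isCont (\<lambda>z. f (fst z) (snd z)) z"
      using has_derivative_continuous[OF smooth_eos_has_derivative[OF assms(1), of "fst z" "snd z"]]
      by (cases z) simp
  qed
  moreover have "continuous_on A (\<lambda>x. (g x, h x))" using assms by (intro continuous_on_Pair)
  ultimately show ?thesis
    using continuous_on_compose2[of "{0<..} \<times> UNIV" "\<lambda>z. f (fst z) (snd z)" A "\<lambda>x. (g x, h x)"] assms(3)
    by force
qed

lemma continuous_on_vector_3:
  fixes a b c :: "'b::topological_space \<Rightarrow> real"
  assumes "continuous_on A a" "continuous_on A b" "continuous_on A c"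
  shows "continuous_on A (\<lambda>x. vector [a x, b x, c x] :: real ^ 3)"
proof -
  have "(\<lambda>x. vector [a x, b x, c x] :: real ^ 3) = (\<lambda>x. a x *\<^sub>R axis 1 1 + b x *\<^sub>R axis 2 1 + c x *\<^sub>R axis 3 1)"
    by (simp add: vec3_eq_iff axis_def fun_eq_iff)
  then show ?thesis using assms by (simp only:) (intro continuous_intros)
qed

lemma continuous_on_hugoniot_state:
  assumes U: "U \<in> states"
  shows "continuous_on UNIV (hugoniot_state U)"
proof -
  let ?f = "hugoniot_volume (U $ 1) (S_state E U)"
  have pos: "U $ 1 > 0" using U by (simp add: states_def)
  have f: "continuous_on UNIV ?f"
    using isCont_hugoniot_volume[OF pos] by (simp add: continuous_on_eq_continuous_at)
  have "continuous_on UNIV (\<lambda>S. E (?f S) S)" "continuous_on UNIV (\<lambda>S. P (?f S) S)"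
    by (intro continuous_on_smooth_compose[OF smooth f] continuous_on_smooth_compose[OF smooth_P f]
        continuous_on_id hugoniot_volume_pos[OF pos])+
  with f show ?thesis
    unfolding hugoniot_state_def[abs_def] Let_def velocity_jump_def
    by (intro continuous_on_vector_3 continuous_intros)
qed

text \<open>Used with \<open>\<epsilon> = 1\<close> for the 1-curve, which starts at \<open>S0\<close> and runs to \<open>\<infinity>\<close>, and with \<open>\<epsilon> = - 1\<close> for the 3-curve, which runs to \<open>- \<infinity>\<close>.\<close>

lemma entropy_chart:
  fixes \<epsilon> S0 :: real
  assumes "\<epsilon> = 1 \<or> \<epsilon> = - 1"
  defines "g \<equiv> \<lambda>\<alpha>. S0 + \<epsilon> * (\<alpha> / (1 - \<alpha>))"
  shows "bij_betw g {0<..<1} {S. 0 < \<epsilon> * (S - S0)}" and "continuous_on {..<1} g" and "g 0 = S0"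
    and "\<And>\<alpha> \<beta>. \<beta> < 1 \<Longrightarrow> \<alpha> < \<beta> \<Longrightarrow> \<epsilon> * g \<alpha> < \<epsilon> * g \<beta>"
proof -
  have sq: "\<epsilon> * (\<epsilon> * x) = x" for x using assms(1) by auto
  show mono: "\<epsilon> * g \<alpha> < \<epsilon> * g \<beta>" if "\<beta> < 1" "\<alpha> < \<beta>" for \<alpha> \<beta>
  proof -
    have "\<alpha> / (1 - \<alpha>) < \<beta> / (1 - \<beta>)" using that by (simp add: field_simps)
    then show ?thesis by (simp add: g_def distrib_left sq)
  qed
  show "g 0 = S0" by (simp add: g_def)
  show "continuous_on {..<1} g" unfolding g_def by (intro continuous_intros) auto
  show "bij_betw g {0<..<1} {S. 0 < \<epsilon> * (S - S0)}"
  proof (rule bij_betw_byWitness[where f' = "\<lambda>S. \<epsilon> * (S - S0) / (1 + \<epsilon> * (S - S0))"])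
    show "\<forall>\<alpha>\<in>{0<..<1}. \<epsilon> * (g \<alpha> - S0) / (1 + \<epsilon> * (g \<alpha> - S0)) = \<alpha>"
    proof
      fix \<alpha> :: real assume "\<alpha> \<in> {0<..<1}"
      then have "\<alpha> / (1 - \<alpha>) / (1 + \<alpha> / (1 - \<alpha>)) = \<alpha>" by (simp add: field_simps)
      moreover have "\<epsilon> * (g \<alpha> - S0) = \<alpha> / (1 - \<alpha>)" by (simp add: g_def sq)
      ultimately show "\<epsilon> * (g \<alpha> - S0) / (1 + \<epsilon> * (g \<alpha> - S0)) = \<alpha>" by simp
    qed
    show "\<forall>S\<in>{S. 0 < \<epsilon> * (S - S0)}. g (\<epsilon> * (S - S0) / (1 + \<epsilon> * (S - S0))) = S"
    proof
      fix S assume "S \<in> {S. 0 < \<epsilon> * (S - S0)}"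
      then have "0 < 1 + \<epsilon> * (S - S0)" by simp
      then have eq: "\<epsilon> * (S - S0) / (1 + \<epsilon> * (S - S0)) / (1 - \<epsilon> * (S - S0) / (1 + \<epsilon> * (S - S0))) = \<epsilon> * (S - S0)"
        by (simp add: field_simps)
      show "g (\<epsilon> * (S - S0) / (1 + \<epsilon> * (S - S0))) = S" unfolding g_def eq sq by simp
    qed
  qed (auto simp: g_def sq pos_divide_less_eq add_pos_pos)
qed

text \<open>The signs combine so that \<open>\<sigma>\<close> decreases along both curves: for 1-shocks \<open>\<sigma> < 0\<close> and \<open>\<sigma>\<^sup>2\<close> grows with the parameter, for 3-shocks \<open>\<sigma> > 0\<close> and \<open>\<sigma>\<^sup>2\<close> decreases.\<close>

lemma hugoniot_monotone:
  assumes \<epsilon>: "\<epsilon> = 1 \<or> \<epsilon> = - 1"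
    and lax: "\<And>U S. U \<in> states \<Longrightarrow> 0 < \<epsilon> * (S - S_state E U) \<Longrightarrow>
        lax_shock E k U (hugoniot_state U S) (- \<epsilon> * sqrt (hugoniot_speed_sq U S))"
    and onto: "\<And>U V \<sigma>. lax_shock E k U V \<sigma> \<Longrightarrow>
        0 < \<epsilon> * (S_state E V - S_state E U) \<and> V = hugoniot_state U (S_state E V)"
    and mono: "\<And>U S S'. U \<in> states \<Longrightarrow> 0 < \<epsilon> * (S - S_state E U) \<Longrightarrow> 0 < \<epsilon> * (S' - S_state E U) \<Longrightarrow>
        S < S' \<Longrightarrow> hugoniot_speed_sq U S < hugoniot_speed_sq U S'"
  shows "monotone_along_hugoniot E k"
  unfolding monotone_along_hugoniot_def
proof
  fix U assume U: "U \<in> states"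
  define g where "g \<alpha> = S_state E U + \<epsilon> * (\<alpha> / (1 - \<alpha>))" for \<alpha>
  define \<gamma> where "\<gamma> \<alpha> = hugoniot_state U (g \<alpha>)" for \<alpha>
  define s where "s \<alpha> = - \<epsilon> * sqrt (hugoniot_speed_sq U (g \<alpha>))" for \<alpha>
  note chart = entropy_chart[OF \<epsilon>, where ?S0.0 = "S_state E U", folded g_def]
  have g_range: "0 < \<epsilon> * (g \<alpha> - S_state E U)" if "\<alpha> \<in> {0<..<1}" for \<alpha>
    using bij_betwE[OF chart(1)] that by blast
  have lax_\<gamma>: "lax_shock E k U (\<gamma> \<alpha>) (s \<alpha>)" if "\<alpha> \<in> {0<..<1}" for \<alpha>
    unfolding \<gamma>_def s_def using U g_range[OF that] by (rule lax)
  have S_\<gamma>: "S_state E (\<gamma> \<alpha>) = g \<alpha>" for \<alpha> by (simp add: \<gamma>_def S_hugoniot_state U)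
  have cont: "continuous_on {..<1} \<gamma>"
    unfolding \<gamma>_def using chart(2) by (rule continuous_on_compose2[OF continuous_on_hugoniot_state[OF U]]) auto
  have "isCont \<gamma> 0" using cont by (rule continuous_on_interior) (simp add: interior_open)
  then have "(\<gamma> \<longlongrightarrow> \<gamma> 0) (at_right 0)" unfolding isCont_def by (simp add: filterlim_at_split)
  then have lim: "(\<gamma> \<longlongrightarrow> U) (at_right 0)" by (simp add: \<gamma>_def chart(3) hugoniot_state_self U)
  have "bij_betw \<gamma> {0<..<1} (forward_hugoniot E k U)"
  proof (rule bij_betw_imageI)
    show "inj_on \<gamma> {0<..<1}"
      using S_\<gamma> bij_betw_imp_inj_on[OF chart(1)] by (metis inj_on_def)
    show "\<gamma> ` {0<..<1} = forward_hugoniot E k U"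
    proof (intro equalityI subsetI)
      fix V assume "V \<in> \<gamma> ` {0<..<1}"
      then show "V \<in> forward_hugoniot E k U" using lax_\<gamma> unfolding forward_hugoniot_def by blast
    next
      fix V assume "V \<in> forward_hugoniot E k U"
      then obtain \<sigma> where "lax_shock E k U V \<sigma>" by (auto simp: forward_hugoniot_def)
      from onto[OF this] have "S_state E V \<in> g ` {0<..<1}" "V = hugoniot_state U (S_state E V)"
        using bij_betw_imp_surj_on[OF chart(1)] by auto
      then show "V \<in> \<gamma> ` {0<..<1}" by (auto simp: \<gamma>_def)
    qed
  qed
  moreover have "continuous_on {0<..<1} \<gamma>" using cont by (rule continuous_on_subset) auto
  ultimately have "hugoniot_parametrization E k U \<gamma> s"
    using lim lax_\<gamma> unfolding hugoniot_parametrization_def by blast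
  moreover have "strictly_monotone_on {0<..<1} (\<lambda>\<alpha>. S_state E (\<gamma> \<alpha>))"
    using \<epsilon> chart(4) unfolding strictly_monotone_on_def S_\<gamma> monotone_on_def by auto
  moreover have "s \<beta> < s \<alpha>" if ab: "\<alpha> \<in> {0<..<1}" "\<beta> \<in> {0<..<1}" "\<alpha> < \<beta>" for \<alpha> \<beta>
  proof -
    have less: "\<epsilon> * g \<alpha> < \<epsilon> * g \<beta>" using ab by (intro chart(4)) auto
    show ?thesis using \<epsilon>
    proof
      assume "\<epsilon> = 1"
      with less mono[OF U g_range[OF ab(1)] g_range[OF ab(2)]] show ?thesis by (simp add: s_def)
    next
      assume "\<epsilon> = - 1"
      with less mono[OF U g_range[OF ab(2)] g_range[OF ab(1)]] show ?thesis by (simp add: s_def)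
    qed
  qed
  then have "strictly_monotone_on {0<..<1} s"
    unfolding strictly_monotone_on_def monotone_on_def by blast
  ultimately show "\<exists>\<gamma> s. hugoniot_parametrization E k U \<gamma> s \<and>
      strictly_monotone_on {0<..<1} (\<lambda>\<alpha>. S_state E (\<gamma> \<alpha>)) \<and> strictly_monotone_on {0<..<1} s"
    by blast
qed

lemma monotone_1: "monotone_along_hugoniot E 1"
  using hugoniot_state_1 lax_1_hugoniot_state hugoniot_speed_sq_mono_1
  by (intro hugoniot_monotone[of 1]) auto

lemma monotone_3: "monotone_along_hugoniot E 3"
  using hugoniot_state_3 lax_3_hugoniot_state hugoniot_speed_sq_mono_3
  by (intro hugoniot_monotone[of "-1"]) auto

theorem structural_conditions_hold: "structural_conditions E"
  unfolding structural_conditions_def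
  using energy pressure_law at_entropy_ends at_volume_ends extreme_fields monotone_1 monotone_3 concave_entropy
  by blast

section \<open>Instability of strong shocks\<close>

text \<open>The Rankine-Hugoniot conditions express \<open>[v]\<close>, \<open>[p]\<close> and \<open>[e]\<close> through \<open>[\<tau>]\<close> and \<open>\<sigma>\<close>, and \<open>p\<^sub>\<tau> = p p\<^sub>e - c\<^sup>2\<close>.\<close>

lemma lopatinski_3:
  assumes lax: "lax_shock E 3 Um Up \<sigma>"
  shows "lopatinski E 3 Um Up = sound_speed E Um * (Up $ 1 - Um $ 1) *
     ((p_state E Um - p_state E Up) * p\<^sub>e Um - (sound_speed E Um)\<^sup>2 - sound_speed E Um * \<sigma>)"
proof -
  define dt dv de where "dt = Up $ 1 - Um $ 1" and "dv = Up $ 2 - Um $ 2" and "de = Up $ 3 - Um $ 3"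
  define c p a where "c = sound_speed E Um" and "p = p_state E Um" and "a = p\<^sub>e Um"
  have st: "Um \<in> states" "Up \<in> states" and "rankine_hugoniot E Um Up \<sigma>" and "\<sigma> > 0"
    using lax by (auto simp: lax_shock_def)
  then have rh: "\<sigma> * dt = - dv" "\<sigma> * dv = p_state E Up - p"
    "de + (p_state E Up + p) / 2 * dt = 0"
    unfolding rankine_hugoniot_iff[OF st] by (simp_all add: dt_def dv_def de_def p_def)
  have dv: "dv = - \<sigma> * dt" using rh(1) by simp
  have p': "p_state E Up = p - \<sigma>\<^sup>2 * dt" using rh(2) unfolding dv by (simp add: power2_eq_square)
  have de: "de = - (p - \<sigma>\<^sup>2 * dt / 2) * dt" using rh(3) unfolding p' by (simp add: field_simps)
  have c: "p\<^sub>\<tau> Um = p * a - c\<^sup>2"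
    using sound_speed_p_hat[OF st(1)] state_signs(2)[OF st(1)] by (simp add: p_def a_def c_def)
  have "lopatinski E 3 Um Up =
      c * p\<^sub>\<tau> Um * dt - dv * (p\<^sub>\<tau> Um - p * a) + c * a * (de + dv\<^sup>2 / 2)"
    unfolding lopatinski_def det_columns_def c_def p_def a_def dt_def dv_def de_def
    by (simp add: det_3 transpose_def A0_mult r1_def r2_def f0_def)
      (simp add: field_simps power2_eq_square)
  also have "\<dots> = c * dt * (\<sigma>\<^sup>2 * dt * a - c\<^sup>2 - c * \<sigma>)"
    unfolding c dv de by (simp add: field_simps power2_eq_square)
  finally show ?thesis unfolding p' by (simp add: c_def p_def a_def dt_def)
qed

text \<open>As the two states merge, \<open>(p\<^sub>- - p\<^sub>+) p\<^sub>e - c\<^sup>2\<close> tends to \<open>- c\<^sup>2 < 0\<close>, and the remaining term of the bracket is negative anyway.\<close>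

lemma lopatinski_3_weak:
  assumes path: "shock_path E 3 Um Up Vm Vp"
  shows "((\<lambda>\<alpha>. sgn (lopatinski E 3 (Vm \<alpha>) (Vp \<alpha>))) \<longlongrightarrow> - 1) (at_right 0)"
proof -
  obtain Us where Us: "Us \<in> states" and lim: "(Vm \<longlongrightarrow> Us) (at_right 0)" "(Vp \<longlongrightarrow> Us) (at_right 0)"
    using path by (auto simp: shock_path_def)
  define G where "G U V = (p_state E U - p_state E V) * (pd2 P (U $ 1) (S_state E U) / T (U $ 1) (S_state E U)) - Qs U"
    for U V
  have cont: "((\<lambda>\<alpha>. f (V \<alpha> $ 1) (S_state E (V \<alpha>))) \<longlongrightarrow> f (Us $ 1) (S_state E Us)) (at_right 0)"
    if "smooth_eos f" "(V \<longlongrightarrow> Us) (at_right 0)" for f V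
    using isCont_tendsto_compose[OF state_continuous[OF that(1) Us] that(2)] .
  have "((\<lambda>\<alpha>. G (Vm \<alpha>) (Vp \<alpha>)) \<longlongrightarrow> G Us Us) (at_right 0)"
    unfolding G_def p_state_eq
    using state_signs(4)[OF Us]
    by (intro tendsto_intros cont lim smooth_P smooth_Q smooth_T smooth_eos_pd) auto
  moreover have "G Us Us < 0" using state_signs(3)[OF Us] by (simp add: G_def)
  ultimately have "\<forall>\<^sub>F \<alpha> in at_right 0. G (Vm \<alpha>) (Vp \<alpha>) < 0" by (rule order_tendstoD)
  moreover have "\<forall>\<^sub>F \<alpha> :: real in at_right 0. \<alpha> \<in> {0<..<1}" by (rule eventually_at_right_real) simp
  ultimately have "\<forall>\<^sub>F \<alpha> in at_right 0. sgn (lopatinski E 3 (Vm \<alpha>) (Vp \<alpha>)) = - 1"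
  proof eventually_elim
    case (elim \<alpha>)
    have "\<alpha> \<in> {0<..1}" using elim by simp
    then obtain \<sigma> where lax: "lax_shock E 3 (Vm \<alpha>) (Vp \<alpha>) \<sigma>"
      using path unfolding shock_path_def by blast
    then have st: "Vm \<alpha> \<in> states" and "\<sigma> > 0" "Vm \<alpha> $ 1 < Vp \<alpha> $ 1"
      unfolding lax_shock_3_iff[of _ _ \<sigma>] using lax by (auto simp: lax_shock_def)
    have "sound_speed E (Vm \<alpha>) * \<sigma> > 0" using state_signs(1)[OF st] \<open>\<sigma> > 0\<close> by simp
    then have "(p_state E (Vm \<alpha>) - p_state E (Vp \<alpha>)) * p\<^sub>e (Vm \<alpha>) - (sound_speed E (Vm \<alpha>))\<^sup>2
        - sound_speed E (Vm \<alpha>) * \<sigma> < 0"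
      using elim by (simp add: G_def pd_p_hat_state[OF st] state_signs(2)[OF st])
    then have "lopatinski E 3 (Vm \<alpha>) (Vp \<alpha>) < 0"
      unfolding lopatinski_3[OF lax] using state_signs(1)[OF st] \<open>Vm \<alpha> $ 1 < Vp \<alpha> $ 1\<close>
      by (intro mult_pos_neg mult_pos_pos) auto
    then show ?case by simp
  qed
  then show ?thesis by (rule tendsto_eventually)
qed

text \<open>The segment of the forward 3-Hugoniot curve from the left state to the right state.\<close>

lemma shock_path_3:
  assumes lax: "lax_shock E 3 Um Up \<sigma>"
  shows "\<exists>Vm Vp. shock_path E 3 Um Up Vm Vp"
proof -
  have Um: "Um \<in> states" using lax by (simp add: lax_shock_def)
  let ?S0 = "S_state E Um" and ?S1 = "S_state E Up"
  define V where "V \<alpha> = hugoniot_state Um (?S0 + \<alpha> * (?S1 - ?S0))" for \<alpha>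
  note Up = lax_3_hugoniot_state[OF lax]
  have cont: "continuous_on UNIV V"
    unfolding V_def by (rule continuous_on_compose2[OF continuous_on_hugoniot_state[OF Um]])
      (auto intro!: continuous_intros)
  have V0: "V 0 = Um" by (simp add: V_def hugoniot_state_self[OF Um])
  have "isCont V 0" using cont by (simp add: continuous_on_eq_continuous_at)
  then have "(V \<longlongrightarrow> V 0) (at_right 0)" unfolding isCont_def by (simp add: filterlim_at_split)
  then have "(V \<longlongrightarrow> Um) (at_right 0)" by (simp add: V0)
  moreover have "\<exists>\<sigma>. lax_shock E 3 Um (V \<alpha>) \<sigma>" if "\<alpha> \<in> {0<..1}" for \<alpha>
  proof -
    have "\<alpha> * (?S1 - ?S0) < 0" using that Up(1) by (simp add: mult_pos_neg)
    then have "?S0 + \<alpha> * (?S1 - ?S0) < ?S0" by simp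
    from hugoniot_state_3[OF Um this] show ?thesis by (auto simp: V_def)
  qed
  moreover have "V 1 = Up" using Up(2) by (simp add: V_def)
  ultimately have "shock_path E 3 Um Up (\<lambda>\<alpha>. Um) V"
    using cont Um unfolding shock_path_def by (auto intro: continuous_on_subset)
  then show ?thesis by blast
qed

text \<open>The factor \<open>2\<close> absorbs the term \<open>c \<sigma> < c\<^sup>2\<close>.\<close>

lemma unstable_3:
  assumes lax: "lax_shock E 3 Um Up \<sigma>"
    and big: "(p_state E Um - p_state E Up) * p\<^sub>e Um > 2 * (sound_speed E Um)\<^sup>2"
  shows "inviscidly_unstable E 3 Um Up"
proof -
  have st: "Um \<in> states" and \<sigma>: "\<sigma> < sound_speed E Um"
    using lax by (auto simp: lax_shock_def)
  have less: "Um $ 1 < Up $ 1" using lax unfolding lax_shock_3_iff[of _ _ \<sigma>] by blast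
  have "sound_speed E Um * \<sigma> < (sound_speed E Um)\<^sup>2"
    using state_signs(1)[OF st] \<sigma> by (simp add: power2_eq_square)
  then have "lopatinski E 3 Um Up > 0"
    unfolding lopatinski_3[OF lax] using state_signs(1)[OF st] less big
    by (intro mult_pos_pos) auto
  then have "\<exists>\<Delta><0. signed_lopatinski_along E 3 Vm Vp \<Delta>" if "shock_path E 3 Um Up Vm Vp" for Vm Vp
    using lopatinski_3_weak[OF that] that unfolding signed_lopatinski_along_def shock_path_def
    by (intro exI[of _ "- lopatinski E 3 Um Up"]) (auto intro!: exI[of _ "-1"])
  then show ?thesis
    using shock_path_3[OF lax] unfolding inviscidly_unstable_def by blast
qed

text \<open>The hypothesis says \<open>p p\<^sub>e > 2 c\<^sup>2\<close> at one state.  The 3-shocks issuing from it can be continued to entropies so low that the pressure ahead is negligible.\<close>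

lemma strong_shock_unstable:
  assumes \<tau>: "\<tau> > 0" and big: "P \<tau> S * pd2 P \<tau> S > 2 * Q \<tau> S * T \<tau> S"
  shows "admits_unstable_shocks E"
proof -
  define Um :: "real ^ 3" where "Um = vector [\<tau>, 0, E \<tau> S]"
  have Um: "Um \<in> states" "Um $ 1 = \<tau>" "S_state E Um = S"
    using signs(1)[OF \<tau>] \<tau> by (simp_all add: Um_def states_def S_state_def)
  let ?a = "pd2 P \<tau> S / T \<tau> S"
  have "((\<lambda>S'. P \<tau> S') \<longlongrightarrow> 0) at_bot"
    using at_entropy_ends \<tau> by (simp add: entropy_limits_def pressure_def)
  then have "((\<lambda>S'. (P \<tau> S - P \<tau> S') * ?a) \<longlongrightarrow> (P \<tau> S - 0) * ?a) at_bot"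
    by (intro tendsto_intros)
  moreover have "2 * Q \<tau> S < (P \<tau> S - 0) * ?a"
    using big signs(3)[OF \<tau>, of S] by (simp add: less_divide_eq)
  ultimately have "\<forall>\<^sub>F S' in at_bot. 2 * Q \<tau> S < (P \<tau> S - P \<tau> S') * ?a" by (rule order_tendstoD)
  moreover have "\<forall>\<^sub>F S' in at_bot. S' < S" by (rule eventually_gt_at_bot)
  ultimately have "\<forall>\<^sub>F S' in at_bot. 2 * Q \<tau> S < (P \<tau> S - P \<tau> S') * ?a \<and> S' < S" by (rule eventually_conj)
  then obtain S' where S': "2 * Q \<tau> S < (P \<tau> S - P \<tau> S') * ?a" "S' < S"
    using eventually_happens'[OF trivial_limit_at_bot_linorder] by blast
  define Up where "Up = hugoniot_state Um S'"
  have lax: "lax_shock E 3 Um Up (sqrt (hugoniot_speed_sq Um S'))"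
    unfolding Up_def using Um S' by (intro hugoniot_state_3) auto
  have "\<tau> < Up $ 1" using lax Um unfolding lax_shock_3_iff by simp
  then have "P (Up $ 1) S' < P \<tau> S'" using \<tau> by (rule P_antimono)
  then have p: "p_state E Up < P \<tau> S'" using Um by (simp add: p_state_eq Up_def S_hugoniot_state)
  have Um_values: "p_state E Um = P \<tau> S" "p\<^sub>e Um = ?a" "(sound_speed E Um)\<^sup>2 = Q \<tau> S"
    unfolding p_state_eq pd_p_hat_state(2)[OF Um(1)] state_signs(2)[OF Um(1)] unfolding Um(2,3) by (rule refl)+
  have "?a > 0" using signs[OF \<tau>, of S] by simp
  then have "(P \<tau> S - P \<tau> S') * ?a < (P \<tau> S - p_state E Up) * ?a" using p by (intro mult_strict_right_mono) auto
  then have "(p_state E Um - p_state E Up) * p\<^sub>e Um > 2 * (sound_speed E Um)\<^sup>2"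
    using S'(1) unfolding Um_values by linarith
  with lax have "inviscidly_unstable E 3 Um Up" by (rule unstable_3)
  with lax show ?thesis unfolding admits_unstable_shocks_def by blast
qed

end

section \<open>The equation of state of the example\<close>

text \<open>The smallest family containing the example and closed under partial differentiation for \<open>\<tau> > 0\<close>.\<close>

definition example_family :: "real \<Rightarrow> real \<Rightarrow> nat \<Rightarrow> real \<Rightarrow> real \<Rightarrow> real \<Rightarrow> real" where
  "example_family C a n b \<tau> S = a * exp S / \<tau> ^ n + b * exp (S / C\<^sup>2 - \<tau> / C)"

lemma example_eos_eq: "example_eos C = example_family C 1 1 (C\<^sup>2)"
  by (simp add: fun_eq_iff example_eos_def example_family_def)

lemma example_family_has_derivative:
  assumes "\<tau> > 0"
  shows "((\<lambda>z. example_family C a n b (fst z) (snd z)) has_derivative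
     (\<lambda>h. example_family C (- (a * real n)) (Suc n) (- b / C) \<tau> S * fst h
        + example_family C a n (b / C\<^sup>2) \<tau> S * snd h)) (at (\<tau>, S))"
proof -
  have p: "((\<lambda>z :: real \<times> real. fst z ^ n) has_derivative (\<lambda>h. real n * \<tau> ^ (n - 1) * fst h)) (at (\<tau>, S))"
    by (auto intro!: derivative_eq_intros simp: fun_eq_iff)
  have q: "real n * \<tau> ^ (n - 1) / (\<tau> ^ n * \<tau> ^ n) = real n / \<tau> ^ Suc n"
    using assms by (cases n) (simp_all add: field_simps)
  have "((\<lambda>z. example_family C a n b (fst z) (snd z)) has_derivative
     (\<lambda>h. a * exp S * snd h / \<tau> ^ n - a * exp S * (real n * \<tau> ^ (n - 1) * fst h) / (\<tau> ^ n * \<tau> ^ n)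
        + b * (exp (S / C\<^sup>2 - \<tau> / C) * (snd h / C\<^sup>2 - fst h / C)))) (at (\<tau>, S))"
    unfolding example_family_def divide_inverse using assms
    by (auto intro!: derivative_eq_intros p simp: fun_eq_iff divide_inverse algebra_simps)
  moreover have "a * exp S * snd h / \<tau> ^ n - a * exp S * (real n * \<tau> ^ (n - 1) * fst h) / (\<tau> ^ n * \<tau> ^ n)
        + b * (exp (S / C\<^sup>2 - \<tau> / C) * (snd h / C\<^sup>2 - fst h / C)) =
      example_family C (- (a * real n)) (Suc n) (- b / C) \<tau> S * fst h
        + example_family C a n (b / C\<^sup>2) \<tau> S * snd h" for h :: "real \<times> real"
  proof -
    have "a * exp S * (real n * \<tau> ^ (n - 1) * fst h) / (\<tau> ^ n * \<tau> ^ n)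
        = a * exp S * fst h * (real n * \<tau> ^ (n - 1) / (\<tau> ^ n * \<tau> ^ n))" by simp
    then show ?thesis unfolding q by (simp add: example_family_def algebra_simps)
  qed
  ultimately show ?thesis by simp
qed

lemma pd_example_family:
  assumes "\<tau> > 0" and f: "\<And>\<tau> S. \<tau> > 0 \<Longrightarrow> f \<tau> S = example_family C a n b \<tau> S"
  shows "pd1 f \<tau> S = example_family C (- (a * real n)) (Suc n) (- b / C) \<tau> S"
    and "pd2 f \<tau> S = example_family C a n (b / C\<^sup>2) \<tau> S"
  using pd_cong_open[OF open_domain, of \<tau> S f "example_family C a n b"] assms
    pd_has_derivative(3,4)[where f = "example_family C a n b", OF example_family_has_derivative[OF assms(1)]]
  by auto

lemma differentiable_example_family:
  "z \<in> {0<..} \<times> UNIV \<Longrightarrow> (\<lambda>(x, y). example_family C a n b x y) differentiable (at z)"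
  using example_family_has_derivative[of "fst z" C a n b "snd z"]
  by (auto simp: differentiable_def case_prod_beta')

lemma C_k_on_example_family: "C_k_on k ({0<..} \<times> UNIV) (example_family C a n b)"
proof (induction k arbitrary: a n b)
  case 0
  show ?case
    unfolding C_k_on.simps
    by (intro continuous_at_imp_continuous_on ballI differentiable_imp_continuous_within
        differentiable_example_family)
next
  case (Suc k)
  have "C_k_on k ({0<..} \<times> UNIV) (pd1 (example_family C a n b))"
    by (rule C_k_on_cong_open[OF open_domain Suc.IH[of "- (a * real n)" "Suc n" "- b / C"]])
      (simp add: pd_example_family(1)[where f = "example_family C a n b"])
  moreover have "C_k_on k ({0<..} \<times> UNIV) (pd2 (example_family C a n b))"
    by (rule C_k_on_cong_open[OF open_domain Suc.IH[of a n "b / C\<^sup>2"]])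
      (simp add: pd_example_family(2)[where f = "example_family C a n b"])
  ultimately show ?case using differentiable_example_family by simp
qed

lemma example_smooth: "smooth_eos (example_eos C)"
  unfolding smooth_eos_def example_eos_eq using C_k_on_example_family by blast

lemma example_partials:
  assumes "\<tau> > 0" "C > 0"
  shows "pressure (example_eos C) \<tau> S = example_family C 1 2 C \<tau> S"
    and "temperature (example_eos C) \<tau> S = example_family C 1 1 1 \<tau> S"
    and "pd1 (pressure (example_eos C)) \<tau> S = example_family C (- 2) 3 (- 1) \<tau> S"
    and "pd2 (pressure (example_eos C)) \<tau> S = example_family C 1 2 (1 / C) \<tau> S"
    and "pd1 (pd1 (pressure (example_eos C))) \<tau> S = example_family C 6 4 (1 / C) \<tau> S"
proof -
  have P: "pressure (example_eos C) \<tau> S = example_family C 1 2 C \<tau> S" if "\<tau> > 0" for \<tau> S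
    using pd_example_family(1)[OF that, of "example_eos C" C 1 1 "C\<^sup>2"] \<open>C > 0\<close>
    by (simp add: pressure_def example_eos_eq) (simp add: example_family_def power2_eq_square)
  then show "pressure (example_eos C) \<tau> S = example_family C 1 2 C \<tau> S" using assms by simp
  show "temperature (example_eos C) \<tau> S = example_family C 1 1 1 \<tau> S"
    using pd_example_family(2)[OF assms(1), of "example_eos C" C 1 1 "C\<^sup>2"] \<open>C > 0\<close>
    by (simp add: temperature_def example_eos_eq)
  have Q: "pd1 (pressure (example_eos C)) \<tau> S = example_family C (- 2) 3 (- 1) \<tau> S" if "\<tau> > 0" for \<tau> S
    using pd_example_family(1)[OF that P] \<open>C > 0\<close> by (simp add: numeral_3_eq_3)
  then show "pd1 (pressure (example_eos C)) \<tau> S = example_family C (- 2) 3 (- 1) \<tau> S" using assms by simp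
  show "pd2 (pressure (example_eos C)) \<tau> S = example_family C 1 2 (1 / C) \<tau> S"
    using pd_example_family(2)[OF assms(1) P] \<open>C > 0\<close> by (simp add: power2_eq_square)
  show "pd1 (pd1 (pressure (example_eos C))) \<tau> S = example_family C 6 4 (1 / C) \<tau> S"
    using pd_example_family(1)[OF assms(1) Q] by simp
qed

lemma example_family_pos: "\<tau> > 0 \<Longrightarrow> a > 0 \<Longrightarrow> b > 0 \<Longrightarrow> example_family C a n b \<tau> S > 0"
  unfolding example_family_def by (intro add_pos_pos divide_pos_pos mult_pos_pos) auto

lemma example_energy_conditions:
  assumes "C > 0" shows "energy_conditions (example_eos C)"
  unfolding energy_conditions_def
proof (intro allI impI)
  fix \<tau> S :: real assume "\<tau> > 0"
  moreover have "example_family C (- 2) 3 (- 1) \<tau> S = - example_family C 2 3 1 \<tau> S"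
    by (simp add: example_family_def)
  ultimately show "example_eos C \<tau> S > 0 \<and> pressure (example_eos C) \<tau> S > 0 \<and>
      temperature (example_eos C) \<tau> S > 0 \<and> pd1 (pressure (example_eos C)) \<tau> S < 0 \<and>
      pd1 (pd1 (pressure (example_eos C))) \<tau> S > 0 \<and> pd2 (pressure (example_eos C)) \<tau> S > 0"
    using example_family_pos assms by (simp add: example_partials) (simp add: example_eos_eq example_family_pos)
qed

lemma example_family_limits:
  assumes "C > 0" "\<tau> > 0" "b > 0"
  shows "((\<lambda>S. example_family C 1 n b \<tau> S) \<longlongrightarrow> 0) at_bot"
    and "filterlim (\<lambda>S. example_family C 1 n b \<tau> S) at_top at_top"
proof -
  have C: "1 / C\<^sup>2 > 0" using assms by simp
  have "LIM S at_bot. 1 / C\<^sup>2 * S :> at_bot"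
    using tendsto_const C filterlim_ident by (rule filterlim_tendsto_pos_mult_at_bot)
  then have "((\<lambda>S. exp (1 / C\<^sup>2 * S)) \<longlongrightarrow> 0) at_bot"
    by (rule filterlim_compose[OF exp_at_bot])
  then have "((\<lambda>S. exp S * (1 / \<tau> ^ n) + b * exp (- \<tau> / C) * exp (1 / C\<^sup>2 * S)) \<longlongrightarrow>
      0 * (1 / \<tau> ^ n) + b * exp (- \<tau> / C) * 0) at_bot"
    by (intro tendsto_intros exp_at_bot)
  then show "((\<lambda>S. example_family C 1 n b \<tau> S) \<longlongrightarrow> 0) at_bot"
    by (simp add: example_family_def mult.assoc flip: exp_add)
  have "LIM S at_top. exp S * (1 / \<tau> ^ n) :> at_top"
    using assms by (intro filterlim_at_top_mult_tendsto_pos[OF tendsto_const _ exp_at_top]) simp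
  then show "filterlim (\<lambda>S. example_family C 1 n b \<tau> S) at_top at_top"
    by (rule filterlim_at_top_mono) (use assms in \<open>simp add: example_family_def\<close>)
qed

lemma example_entropy_limits:
  assumes "C > 0" shows "entropy_limits (example_eos C)"
  unfolding entropy_limits_def
proof (intro allI impI)
  fix \<tau> :: real assume "\<tau> > 0"
  moreover have "- pd1 (example_eos C) \<tau> S = example_family C 1 2 C \<tau> S" for S
    using example_partials(1)[OF \<open>\<tau> > 0\<close> assms] by (simp add: pressure_def)
  ultimately show "((\<lambda>S. example_eos C \<tau> S) \<longlongrightarrow> 0) at_bot \<and> filterlim (\<lambda>S. example_eos C \<tau> S) at_top at_top \<and>
      ((\<lambda>S. - pd1 (example_eos C) \<tau> S) \<longlongrightarrow> 0) at_bot \<and> filterlim (\<lambda>S. - pd1 (example_eos C) \<tau> S) at_top at_top"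
    using example_family_limits[OF assms] assms by (simp add: example_eos_eq)
qed

lemma example_equation_of_state: "C > 0 \<Longrightarrow> equation_of_state (example_eos C)"
  by unfold_locales (simp_all add: example_smooth example_energy_conditions example_entropy_limits)

text \<open>For fixed pressure \<open>p\<close> the first pressure term gives \<open>exp S \<le> p \<tau>\<^sup>2\<close>, which makes both energy terms small with \<open>\<tau>\<close>.\<close>

lemma example_volume_limits:
  assumes C: "C > 0" shows "volume_limits (example_eos C)"
  unfolding volume_limits_def
proof (intro conjI allI impI)
  fix S :: real
  have "((\<lambda>\<tau>. exp S / \<tau>) \<longlongrightarrow> 0) at_top"
    by (intro tendsto_divide_0[OF tendsto_const] filterlim_at_top_imp_at_infinity filterlim_ident)
  moreover have "((\<lambda>\<tau>. exp (S / C\<^sup>2 - \<tau> / C)) \<longlongrightarrow> 0) at_top"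
  proof -
    have "LIM \<tau> at_top. - (S / C\<^sup>2) + \<tau> * (1 / C) :> at_top"
      using C by (intro filterlim_tendsto_add_at_top[OF tendsto_const]
          filterlim_at_top_mult_tendsto_pos[OF tendsto_const _ filterlim_ident]) simp
    from filterlim_compose[OF exp_at_bot filterlim_compose[OF filterlim_uminus_at_bot_at_top this]]
    show ?thesis by simp
  qed
  ultimately have "((\<lambda>\<tau>. exp S / \<tau> + C\<^sup>2 * exp (S / C\<^sup>2 - \<tau> / C)) \<longlongrightarrow> 0 + C\<^sup>2 * 0) at_top"
    by (intro tendsto_intros)
  then show "((\<lambda>\<tau>. example_eos C \<tau> S) \<longlongrightarrow> 0) at_top" by (simp add: example_eos_def)
next
  fix p :: real assume p: "p > 0"
  interpret equation_of_state "example_eos C" using C by (rule example_equation_of_state)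
  define a where "a = 1 / C\<^sup>2"
  have a: "a > 0" using C by (simp add: a_def)
  have upper: "e_check (example_eos C) \<tau> p \<le> p * \<tau> + C\<^sup>2 * (p * \<tau>\<^sup>2) powr a" if \<tau>: "\<tau> > 0" for \<tau>
  proof -
    let ?S = "S_check (example_eos C) \<tau> p"
    have "exp ?S / \<tau>\<^sup>2 + C * exp (?S / C\<^sup>2 - \<tau> / C) = p"
      using P_S_check[OF \<tau> p] example_partials(1)[OF \<tau> C] by (simp add: example_family_def)
    moreover have "C * exp (?S / C\<^sup>2 - \<tau> / C) > 0" using C by simp
    ultimately have "exp ?S / \<tau>\<^sup>2 \<le> p" by linarith
    then have le: "exp ?S \<le> p * \<tau>\<^sup>2" using \<tau> by (simp add: pos_divide_le_eq)
    then have "exp ?S / \<tau> \<le> p * \<tau>" using \<tau> by (simp add: pos_divide_le_eq power2_eq_square mult.assoc)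
    moreover have "exp (?S / C\<^sup>2 - \<tau> / C) \<le> exp (?S / C\<^sup>2)" using \<tau> C by simp
    moreover have "exp (?S / C\<^sup>2) = exp ?S powr a" by (simp add: powr_def a_def)
    moreover have "exp ?S powr a \<le> (p * \<tau>\<^sup>2) powr a" using a le by (intro powr_mono2) auto
    ultimately show ?thesis
      unfolding e_check_def example_eos_def by (intro add_mono mult_left_mono) auto
  qed
  have "((\<lambda>\<tau>. p * \<tau>\<^sup>2) \<longlongrightarrow> p * 0\<^sup>2) (at_right 0)" by (intro tendsto_intros)
  then have "((\<lambda>\<tau>. (p * \<tau>\<^sup>2) powr a) \<longlongrightarrow> 0 powr a) (at_right 0)"
    using a p by (intro tendsto_powr' tendsto_const) (auto intro!: always_eventually)
  then have "((\<lambda>\<tau>. p * \<tau> + C\<^sup>2 * (p * \<tau>\<^sup>2) powr a) \<longlongrightarrow> p * 0 + C\<^sup>2 * 0 powr a) (at_right 0)"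
    by (intro tendsto_add tendsto_mult_left tendsto_ident_at)
  then have lim: "((\<lambda>\<tau>. p * \<tau> + C\<^sup>2 * (p * \<tau>\<^sup>2) powr a) \<longlongrightarrow> 0) (at_right 0)" using a by simp
  have pos: "\<forall>\<^sub>F \<tau> :: real in at_right 0. \<tau> > 0" by (rule eventually_at_right_less)
  show "((\<lambda>\<tau>. e_check (example_eos C) \<tau> p) \<longlongrightarrow> 0) (at_right 0)"
  proof (rule tendsto_sandwich[OF _ _ tendsto_const lim])
    show "\<forall>\<^sub>F \<tau> in at_right 0. 0 \<le> e_check (example_eos C) \<tau> p"
      using pos by eventually_elim (simp add: e_check_def signs(1) less_imp_le)
    show "\<forall>\<^sub>F \<tau> in at_right 0. e_check (example_eos C) \<tau> p \<le> p * \<tau> + C\<^sup>2 * (p * \<tau>\<^sup>2) powr a"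
      using pos by eventually_elim (rule upper)
  qed
qed

text \<open>The first term is \<open>exp (S - ln \<tau>)\<close>, the exponential of a convex function; the second is the exponential of an affine one.\<close>

lemma example_convex: "convex_on ({0<..} \<times> UNIV) (\<lambda>(\<tau>, S). example_eos C \<tau> S)"
  unfolding convex_on_def
proof (intro conjI ballI allI impI)
  show "convex ({0<..} \<times> UNIV :: (real \<times> real) set)" by (intro convex_Times) auto
  fix y z :: "real \<times> real" and u v :: real
  assume yz: "y \<in> {0<..} \<times> UNIV" "z \<in> {0<..} \<times> UNIV" and uv: "u \<ge> 0" "v \<ge> 0" "u + v = 1"
  obtain a S b R where y: "y = (a, S)" and z: "z = (b, R)" by (cases y, cases z) auto
  have pos: "a > 0" "b > 0" using yz by (auto simp: y z)
  have exp: "exp (u * s + v * r) \<le> u * exp s + v * exp r" for s r :: real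
    using exp_convex[THEN convex_onD, of v s r] uv by (simp add: eq_diff_eq[symmetric])
  have c: "u * a + v * b > 0"
    using pos uv by (cases "u = 0") (auto intro: add_pos_nonneg)
  have "u * ln a + v * ln b \<le> ln (u * a + v * b)"
    using ln_concave[THEN concave_onD, of v a b] pos uv by (simp add: eq_diff_eq[symmetric])
  then have "exp (u * S + v * R - ln (u * a + v * b)) \<le> exp (u * (S - ln a) + v * (R - ln b))"
    by (simp add: algebra_simps)
  also have "\<dots> \<le> u * exp (S - ln a) + v * exp (R - ln b)" by (rule exp)
  finally have 1: "exp (u * S + v * R) / (u * a + v * b) \<le> u * (exp S / a) + v * (exp R / b)"
    using pos c by (simp add: exp_diff)
  have "(u * S + v * R) / C\<^sup>2 - (u * a + v * b) / C = u * (S / C\<^sup>2 - a / C) + v * (R / C\<^sup>2 - b / C)"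
    by (simp add: algebra_simps add_divide_distrib)
  then have "exp ((u * S + v * R) / C\<^sup>2 - (u * a + v * b) / C) \<le>
      u * exp (S / C\<^sup>2 - a / C) + v * exp (R / C\<^sup>2 - b / C)" using exp by simp
  then have "C\<^sup>2 * exp ((u * S + v * R) / C\<^sup>2 - (u * a + v * b) / C) \<le>
      C\<^sup>2 * (u * exp (S / C\<^sup>2 - a / C) + v * exp (R / C\<^sup>2 - b / C))" by (rule mult_left_mono) simp
  with 1 show "(case u *\<^sub>R y + v *\<^sub>R z of (\<tau>, S) \<Rightarrow> example_eos C \<tau> S)
      \<le> u * (case y of (\<tau>, S) \<Rightarrow> example_eos C \<tau> S) + v * (case z of (\<tau>, S) \<Rightarrow> example_eos C \<tau> S)"
    by (simp add: y z example_eos_def algebra_simps)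
qed

lemma example_gas: "C > 0 \<Longrightarrow> gas (example_eos C)"
  by (simp add: gas_def gas_axioms_def example_equation_of_state example_volume_limits example_convex)

text \<open>At \<open>\<tau> = 1\<close>, \<open>S = 0\<close> all quantities are explicit in \<open>w = exp (- 1 / C)\<close>, which lies between \<open>1/3\<close> and \<open>1\<close>.\<close>

lemma example_unstable:
  assumes C: "C \<ge> 36" shows "admits_unstable_shocks (example_eos C)"
proof -
  interpret gas "example_eos C" using C by (intro example_gas) simp
  define w where "w = exp (- 1 / C)"
  have "exp (- 1) \<le> w" using C by (simp add: w_def)
  moreover have "exp (- 1) \<ge> (1 / 3 :: real)" using exp_le by (simp add: exp_minus field_simps)
  ultimately have w: "1 / 3 \<le> w" by linarith
  have w1: "w \<le> 1" using C by (simp add: w_def)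
  \<comment> \<open>\<open>36\<close> is chosen so that \<open>C w \<ge> 12\<close>, the bound \<open>12\<close> being \<open>2 (2 + w) (1 + w)\<close> at \<open>w = 1\<close>\<close>
  have "12 * 1 < (1 + C * w) * (1 + w / C)"
  proof (rule mult_less_le_imp_less)
    have "36 * (1 / 3) \<le> C * w" using C w by (intro mult_mono) auto
    then show "12 < 1 + C * w" by simp
  qed (use C w in auto)
  moreover have "2 * (2 + w) * (1 + w) \<le> (2 * 3) * 2" using w w1 by (intro mult_mono) auto
  ultimately have "2 * (2 + w) * (1 + w) < (1 + C * w) * (1 + w / C)" by simp
  moreover have "P 1 0 = 1 + C * w" "pd2 P 1 0 = 1 + w / C" "Q 1 0 = 2 + w" "T 1 0 = 1 + w"
    using example_partials[of 1 C 0] C by (simp_all add: Q_def example_family_def w_def)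
  ultimately show ?thesis using strong_shock_unstable[of 1 0] by simp
qed

section \<open>Existence of the equations of state\<close>

theorem theoremA:
  shows "(\<exists>E. smooth_eos E \<and> structural_conditions E \<and> admits_unstable_shocks E) \<and>
    (\<exists>C0>0. \<forall>C\<ge>C0. smooth_eos (example_eos C) \<and> structural_conditions (example_eos C) \<and>
       admits_unstable_shocks (example_eos C))"
proof -
  have "smooth_eos (example_eos C) \<and> structural_conditions (example_eos C) \<and>
      admits_unstable_shocks (example_eos C)" if "C \<ge> 36" for C
    using that example_smooth example_unstable gas.structural_conditions_hold[OF example_gas] by simp
  then show ?thesis by (meson order_refl zero_less_numeral)
qed

end
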